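(* Let $A$ be an abelian group with $|A|<2^{\aleph_0}$. Then the following are equivalent: (1) $A$ is slender; (2) $A$ is n-slender; (3) $A$ is cm-slender; (4) $A$ is lcH-slender.
   Context: An abelian group $A$ is slender if for every homomorphism $\phi:\prod_{\mathbb{N}}\mathbb{Z}\to A$ there is $n\in\mathbb{N}$ with $\phi=\phi\circ p_n$, where $p_n:\prod_{\mathbb{N}}\mathbb{Z}\to\prod_{\mathbb{N}}\mathbb{Z}$ sends a sequence to the sequence agreeing with it in the first $n$ coordinates and zero elsewhere. Let $E=\bigcup_{n\in\mathbb{N}}C((0,\tfrac1n),\tfrac1n)\subseteq\mathbb{R}^2$ be the Hawaiian earring ($C(q,r)$ the circle of center $q$, radius $r$), and $\mathbb{H}=\pi_1(E,(0,0))$. For $N\in\mathbb{N}$ let $p_N:\mathbb{H}\to\mathbb{H}$ be the homomorphism induced by the retraction of $E$ onto the union of the first $N$ circles collapsing the other circles to the base point. A group $G$ is n-slender if for every homomorphism $\phi:\mathbb{H}\to G$ there is $N$ with $\phi=\phi\circ p_N$. A group is cm-slender if every homomorphism to it from a completely metrizable topological group has open kernel, and lcH-slender if every homomorphism to it from a locally compact Hausdorff topological group has open kernel. *)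

theory Defs
  imports "HOL-Analysis.Analysis" "HOL-Algebra.Algebra" "HOL-Library.Equipollence"
begin

definition ZN :: "(nat \<Rightarrow> int) monoid" where
  "ZN = \<lparr>carrier = UNIV, mult = (\<lambda>x y i. x i + y i), one = (\<lambda>i. 0)\<rparr>"

definition trunc_seq :: "nat \<Rightarrow> (nat \<Rightarrow> int) \<Rightarrow> (nat \<Rightarrow> int)" where
  "trunc_seq n x = (\<lambda>i. if i < n then x i else 0)"

definition slender :: "('a, 'b) monoid_scheme \<Rightarrow> bool" where
  "slender A \<longleftrightarrow> (\<forall>\<phi> \<in> hom ZN A. \<exists>n. \<forall>x \<in> carrier ZN. \<phi> x = \<phi> (trunc_seq n x))"

definition HE_circle :: "nat \<Rightarrow> (real \<times> real) set" where
  "HE_circle n = sphere (0, 1 / real n) (1 / real n)"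

definition hawaiian_earring :: "(real \<times> real) set" where
  "hawaiian_earring = (\<Union>n\<in>{1..}. HE_circle n)"

definition HE_loops :: "(real \<Rightarrow> real \<times> real) set" where
  "HE_loops = {p. path p \<and> path_image p \<subseteq> hawaiian_earring \<and>
                  pathstart p = (0,0) \<and> pathfinish p = (0,0)}"

definition HE_class :: "(real \<Rightarrow> real \<times> real) \<Rightarrow> (real \<Rightarrow> real \<times> real) set" where
  "HE_class p = {q. homotopic_paths hawaiian_earring p q}"

definition HE_group :: "(real \<Rightarrow> real \<times> real) set monoid" where
  "HE_group = \<lparr>carrier = HE_class ` HE_loops,
     mult = (\<lambda>a b. HE_class ((SOME p. p \<in> a) +++ (SOME q. q \<in> b))),
     one = HE_class (linepath (0,0) (0,0))\<rparr>"

definition HE_retract :: "nat \<Rightarrow> real \<times> real \<Rightarrow> real \<times> real" where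
  "HE_retract N z = (if z \<in> (\<Union>n\<in>{1..N}. HE_circle n) then z else (0,0))"

definition HE_proj :: "nat \<Rightarrow> (real \<Rightarrow> real \<times> real) set \<Rightarrow> (real \<Rightarrow> real \<times> real) set" where
  "HE_proj N a = HE_class (HE_retract N \<circ> (SOME p. p \<in> a))"

definition n_slender :: "('a, 'b) monoid_scheme \<Rightarrow> bool" where
  "n_slender G \<longleftrightarrow> (\<forall>\<phi> \<in> hom HE_group G. \<exists>N. \<forall>a \<in> carrier HE_group. \<phi> a = \<phi> (HE_proj N a))"

definition topological_group :: "('g, 'm) monoid_scheme \<Rightarrow> 'g topology \<Rightarrow> bool" where
  "topological_group G T \<longleftrightarrow> group G \<and> topspace T = carrier G \<and>
     continuous_map (prod_topology T T) T (\<lambda>(x, y). x \<otimes>\<^bsub>G\<^esub> y) \<and>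
     continuous_map T T (\<lambda>x. inv\<^bsub>G\<^esub> x)"

definition cm_slender :: "'g itself \<Rightarrow> ('a, 'b) monoid_scheme \<Rightarrow> bool" where
  "cm_slender (_::'g itself) A \<longleftrightarrow>
     (\<forall>(G::'g monoid) T \<phi>. topological_group G T \<and> completely_metrizable_space T \<and>
        \<phi> \<in> hom G A \<longrightarrow> openin T (kernel G A \<phi>))"

definition lcH_slender :: "'g itself \<Rightarrow> ('a, 'b) monoid_scheme \<Rightarrow> bool" where
  "lcH_slender (_::'g itself) A \<longleftrightarrow>
     (\<forall>(G::'g monoid) T \<phi>. topological_group G T \<and> locally_compact_space T \<and>
        Hausdorff_space T \<and> \<phi> \<in> hom G A \<longrightarrow> openin T (kernel G A \<phi>))"

end

theory Submission
  imports Defs "HOL-Complex_Analysis.Winding_Numbers" "HOL-Library.Function_Algebras"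
begin

text \<open>All four properties are equivalent to \<open>A\<close> being torsion-free and reduced.

  Suppose \<open>A\<close> is torsion-free and reduced, and \<open>\<phi>\<close> is a homomorphism into \<open>A\<close> that is nontrivial
  arbitrarily close to the identity. Choose \<open>g n\<close> converging quickly to the identity with
  \<open>\<phi> (g n) \<noteq> 1\<close> and exponents \<open>k n\<close> such that \<open>\<phi> (g n)\<close> is not a \<open>k n\<close>-th power. For every 0-1 sequence
  \<open>e\<close> the system \<open>x n = g n ^ e n * x (n + 1) ^ k n\<close> can be solved by completeness, by compactness, or
  by infinite concatenation of loops, and the value \<open>\<phi> (x 0)\<close> determines \<open>e\<close>: at the first place where
  two sequences differ, cancelling would make \<open>\<phi> (g n)\<close> a \<open>k n\<close>-th power. So \<open>A\<close> has at least
  continuum many elements. In the Hawaiian earring the \<open>g n\<close> must be loops in the circles beyond the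
  \<open>n\<close>-th; they exist because every loop is homotopic to a finite product of loops each lying either in
  the first \<open>n\<close> circles or in the remaining ones.

  Conversely, if \<open>A\<close> contains a nontrivial element of finite order or a nontrivial image of the
  rationals, then a cluster point of the coordinate projections, respectively a rational linear
  functional, gives a homomorphism from the integer sequences to \<open>A\<close> that kills all finitely supported
  sequences but not the constant sequence 1; winding numbers pull it back to the earring group. The
  same construction on a power of a finite cyclic group, respectively on the reals, gives a
  homomorphism whose kernel is not open.\<close>

section \<open>Coding binary sequences in torsion-free reduced groups\<close>

definition torsion_free :: "('a, 'b) monoid_scheme \<Rightarrow> bool" where
  "torsion_free A \<longleftrightarrow> (\<forall>a\<in>carrier A. \<forall>k::nat. 0 < k \<longrightarrow> a [^]\<^bsub>A\<^esub> k = \<one>\<^bsub>A\<^esub> \<longrightarrow> a = \<one>\<^bsub>A\<^esub>)"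

text \<open>In a torsion-free abelian group the elements with roots of every order form the largest
  divisible subgroup, so for such groups this is reducedness.\<close>

definition no_divisible_elem :: "('a, 'b) monoid_scheme \<Rightarrow> bool" where
  "no_divisible_elem A \<longleftrightarrow> (\<forall>a\<in>carrier A. a \<noteq> \<one>\<^bsub>A\<^esub> \<longrightarrow>
     (\<exists>k::nat. 0 < k \<and> (\<forall>b\<in>carrier A. b [^]\<^bsub>A\<^esub> k \<noteq> a)))"

section \<open>Nested power equations and the bits they encode\<close>

definition step :: "('g, 'm) monoid_scheme \<Rightarrow> (nat \<Rightarrow> 'g) \<Rightarrow> (nat \<Rightarrow> nat) \<Rightarrow> (nat \<Rightarrow> bool) \<Rightarrow> nat \<Rightarrow> 'g \<Rightarrow> 'g" where
  "step G g k e n y = (if e n then g n else \<one>\<^bsub>G\<^esub>) \<otimes>\<^bsub>G\<^esub> y [^]\<^bsub>G\<^esub> k n"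

text \<open>If \<open>x n = step G g k e n (x (Suc n))\<close> for all \<open>n\<close>, then
  \<open>x 0 = nest G g k e n (x n)\<close>. The recursion adds step \<open>n\<close> innermost, so
  only the bits below \<open>n\<close> enter.\<close>

primrec nest :: "('g, 'm) monoid_scheme \<Rightarrow> (nat \<Rightarrow> 'g) \<Rightarrow> (nat \<Rightarrow> nat) \<Rightarrow> (nat \<Rightarrow> bool) \<Rightarrow> nat \<Rightarrow> 'g \<Rightarrow> 'g" where
  "nest G g k e 0 y = y"
| "nest G g k e (Suc n) y = nest G g k e n (step G g k e n y)"

lemma nest_cong_prefix:
  assumes "\<And>i. i < n \<Longrightarrow> e i = e' i"
  shows "nest G g k e n y = nest G g k e' n y"
  using assms by (induction n arbitrary: y) (auto simp: step_def)

lemma (in group) step_closed: "range g \<subseteq> carrier G \<Longrightarrow> y \<in> carrier G \<Longrightarrow> step G g k e n y \<in> carrier G"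
  unfolding step_def by (simp add: image_subset_iff)

lemma (in group_hom) hom_nest:
  assumes "range g \<subseteq> carrier G" "y \<in> carrier G"
  shows "h (nest G g k e n y) = nest H (h \<circ> g) k e n (h y)"
  using assms(2)
proof (induction n arbitrary: y)
  case (Suc n)
  have "h (step G g k e n y) = step H (h \<circ> g) k e n (h y)"
    using assms(1) Suc.prems unfolding step_def by (auto simp: image_subset_iff hom_nat_pow)
  then show ?case
    using Suc assms(1) by (simp add: G.step_closed comp_def)
qed auto

lemma (in comm_group) torsion_free_pow_inj:
  assumes "torsion_free G" "x \<in> carrier G" "y \<in> carrier G" "0 < (k::nat)" "x [^] k = y [^] k"
  shows "x = y"
proof -
  have "(x \<otimes> inv y) [^] k = \<one>"
    using assms by (simp add: pow_mult_distrib m_comm nat_pow_inv r_inv)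
  then have "x \<otimes> inv y = \<one>"
    using assms unfolding torsion_free_def by simp
  then show ?thesis using assms by (metis inv_closed inv_equality inv_inv)
qed

text \<open>The bound on the size of \<open>A\<close> is the absence of an injection from the reals;
  by choice this is cardinality below the continuum.\<close>

locale small_tf_reduced_group = comm_group A for A (structure) +
  assumes tf: "torsion_free A" and red: "no_divisible_elem A"
    and small: "\<not> (UNIV :: real set) \<lesssim> carrier A"
begin

text \<open>Each step can be undone: cancel the left factor, then extract the root of order
  \<open>k n\<close>, which is unique in a torsion-free group.\<close>

lemma nest_inj:
  assumes "range a \<subseteq> carrier A" "\<And>n. 0 < k n" "x \<in> carrier A" "y \<in> carrier A"
    "nest A a k e n x = nest A a k e n y"
  shows "x = y"
  using assms(3-5)
proof (induction n arbitrary: x y)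
  case (Suc n)
  have "step A a k e n x = step A a k e n y"
    using Suc assms(1) by (simp add: step_closed)
  then have "x [^] k n = y [^] k n"
    using Suc.prems assms(1) unfolding step_def
    by (auto simp: image_subset_iff split: if_splits)
  then show ?case using torsion_free_pow_inj[OF tf] assms(2) Suc.prems by blast
qed auto

text \<open>The hypothesis \<open>sol\<close> allows an unrelated tail \<open>y\<close> for every
  \<open>n\<close>, the form in which compactness delivers a solution. Two codes are compared only
  at the tails just after their first disagreement.\<close>

lemma nest_coding:
  assumes a: "range a \<subseteq> carrier A" and k: "\<And>n. 0 < k n"
    and ndiv: "\<And>n b. b \<in> carrier A \<Longrightarrow> b [^] k n \<noteq> a n"
    and sol: "\<And>e. \<exists>b\<in>carrier A. \<forall>n. \<exists>y\<in>carrier A. b = nest A a k e n y"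
  shows False
proof -
  obtain b where bc: "\<And>e. b e \<in> carrier A" and b: "\<And>e n. \<exists>y\<in>carrier A. b e = nest A a k e n y"
    using sol by metis
  have "e = e'" if eq: "b e = b e'" for e e'
  proof (rule ccontr)
    assume "e \<noteq> e'"
    then have ex: "\<exists>n. e n \<noteq> e' n" by auto
    define n where "n = (LEAST n. e n \<noteq> e' n)"
    have n: "e n \<noteq> e' n" unfolding n_def using ex by (rule LeastI_ex)
    have less: "e i = e' i" if "i < n" for i using not_less_Least that unfolding n_def by blast
    obtain y y' where y: "y \<in> carrier A" "y' \<in> carrier A"
      "b e = nest A a k e (Suc n) y" "b e' = nest A a k e' (Suc n) y'"
      using b by meson
    \<comment> \<open>The first \<open>n\<close> bits agree, so both codes apply the same outer map
      \<open>nest A a k e n\<close>, which is injective.\<close>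
    have s0: "nest A a k e n (step A a k e n y) = nest A a k e n (step A a k e' n y')"
    proof -
      have "nest A a k e n (step A a k e n y) = nest A a k e' n (step A a k e' n y')"
        using y eq by simp
      also have "\<dots> = nest A a k e n (step A a k e' n y')"
        by (rule nest_cong_prefix) (simp add: less)
      finally show ?thesis .
    qed
    have s: "step A a k e n y = step A a k e' n y'"
      using a y by (intro nest_inj[OF a k _ _ s0] step_closed)
    have an: "a n \<in> carrier A" using a by auto
    \<comment> \<open>Exactly one of the two steps contains the factor \<open>a n\<close>;
      commutativity turns the quotient of the two powers into a power of a quotient, contrary to
      \<open>ndiv\<close>.\<close>
    have key: "False" if "u \<in> carrier A" "v \<in> carrier A" "a n \<otimes> u [^] k n = v [^] k n" for u v
    proof -
      have "a n = v [^] k n \<otimes> inv (u [^] k n)" using that an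
        by (simp add: inv_solve_right)
      also have "\<dots> = (v \<otimes> inv u) [^] k n" using that by (simp add: pow_mult_distrib m_comm nat_pow_inv)
      finally show False using ndiv[of "v \<otimes> inv u" n] that by simp
    qed
    show False using s n y key[of y y'] key[of y' y] unfolding step_def by (auto split: if_splits)
  qed
  then have "inj b" by (auto intro: injI)
  then have "(UNIV :: (nat \<Rightarrow> bool) set) \<lesssim> carrier A"
    unfolding lepoll_def using bc by blast
  \<comment> \<open>The Boolean sequences have at least the size of the continuum, through subsets
    of the naturals.\<close>
  moreover have "(UNIV :: nat set set) \<lesssim> (UNIV :: (nat \<Rightarrow> bool) set)"
    unfolding lepoll_def by (rule exI[of _ "\<lambda>S n. n \<in> S"]) (auto simp: inj_on_def fun_eq_iff)
  ultimately show False
    using small nat_sets_eqpoll_reals by (meson eqpoll_imp_lepoll eqpoll_sym lepoll_trans)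
qed

end

section \<open>Completely metrizable and locally compact groups\<close>

lemma continuous_map_step:
  assumes "topological_group G T" "c \<in> carrier G"
  shows "continuous_map T T (\<lambda>y. c \<otimes>\<^bsub>G\<^esub> y [^]\<^bsub>G\<^esub> (k::nat))"
proof -
  interpret group G using assms unfolding topological_group_def by blast
  have ts: "topspace T = carrier G"
    and cm: "continuous_map (prod_topology T T) T (\<lambda>(x, y). x \<otimes>\<^bsub>G\<^esub> y)"
    using assms unfolding topological_group_def by auto
  have mult: "continuous_map T T (\<lambda>y. f y \<otimes>\<^bsub>G\<^esub> h y)"
    if "continuous_map T T f" "continuous_map T T h" for f h
    using continuous_map_compose[OF continuous_map_pairedI[OF that] cm] by (simp add: o_def)
  have "continuous_map T T (\<lambda>y. y [^]\<^bsub>G\<^esub> (k::nat))"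
    by (induction k) (auto intro: mult simp: ts)
  then show ?thesis
    by (intro mult) (auto simp: ts assms(2))
qed

text \<open>\<open>Q\<close> is the smallness demanded of the neighbourhood \<open>U n\<close>, left
  open so that one induction serves both compactness and completeness. \<open>\<Phi> n\<close>
  collects the composites of earlier steps, for either value of each bit; it stays finite, so one
  choice of \<open>U n\<close> serves all sequences \<open>e\<close> at once.\<close>

lemma (in small_tf_reduced_group) exists_step_sequence:
  fixes G :: "('g, 'm) monoid_scheme"
  assumes TG: "topological_group G T" and \<phi>: "\<phi> \<in> hom G A"
    and nopen: "\<not> openin T (kernel G A \<phi>)"
    and Qex: "\<And>n \<Phi>. finite \<Phi> \<Longrightarrow> (\<And>h. h \<in> \<Phi> \<Longrightarrow> continuous_map T T h) \<Longrightarrow>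
                \<exists>U. openin T U \<and> \<one>\<^bsub>G\<^esub> \<in> U \<and> Q (n::nat) \<Phi> U"
    and Qmono: "\<And>n \<Phi> U V. Q n \<Phi> U \<Longrightarrow> V \<subseteq> U \<Longrightarrow> Q n \<Phi> V"
  obtains g k U \<Phi> where "range g \<subseteq> carrier G" "\<And>n. 0 < k n"
    "\<And>n b. b \<in> carrier A \<Longrightarrow> b [^] k n \<noteq> \<phi> (g n)"
    "\<And>n. openin T (U n)" "\<And>n. \<one>\<^bsub>G\<^esub> \<in> U n"
    "\<And>e n y. y \<in> U (Suc n) \<Longrightarrow> step G g k e n y \<in> U n"
    "\<And>n. Q n (\<Phi> n) (U n)" "\<And>n. (\<lambda>x. x) \<in> \<Phi> n"
    "\<And>n h e. h \<in> \<Phi> n \<Longrightarrow> h \<circ> step G g k e n \<in> \<Phi> (Suc n)"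
proof -
  interpret G: group G using TG unfolding topological_group_def by blast
  interpret \<phi>: group_hom G A \<phi> by (unfold_locales) (rule \<phi>)
  have ts: "topspace T = carrier G" using TG unfolding topological_group_def by auto
  \<comment> \<open>Otherwise \<open>\<phi>\<close> is trivial on a neighbourhood \<open>U\<close>
    of the identity, and translating \<open>U\<close> to the points of the kernel makes the kernel
    open.\<close>
  have nbhd: "\<exists>g\<in>U. \<phi> g \<noteq> \<one>" if U: "openin T U" "\<one>\<^bsub>G\<^esub> \<in> U" for U
  proof (rule ccontr)
    assume neg: "\<not> ?thesis"
    have "\<exists>V. openin T V \<and> x \<in> V \<and> V \<subseteq> kernel G A \<phi>" if x: "x \<in> kernel G A \<phi>" for x
    proof (intro exI conjI)
      have xc: "x \<in> carrier G" "\<phi> x = \<one>" using x by (auto simp: kernel_def)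
      \<comment> \<open>The exponent 1 makes left translation an instance of
        \<open>continuous_map_step\<close>.\<close>
      let ?V = "{y \<in> topspace T. inv\<^bsub>G\<^esub> x \<otimes>\<^bsub>G\<^esub> y [^]\<^bsub>G\<^esub> (1::nat) \<in> U}"
      show "openin T ?V"
        using continuous_map_step[OF TG, of "inv\<^bsub>G\<^esub> x" 1] xc U by (intro openin_continuous_map_preimage) auto
      show "x \<in> ?V" using xc U by (simp add: ts)
      show "?V \<subseteq> kernel G A \<phi>"
        using neg xc by (fastforce simp: ts kernel_def)
    qed
    then show False using nopen openin_subopen[of T "kernel G A \<phi>"] by blast
  qed
  \<comment> \<open>\<open>f\<close> is \<open>step\<close> at a single stage, with the element, the
    exponent and the bit as arguments, since the sequences are still under construction.\<close>
  define f where "f a c b y = (if b then a else \<one>\<^bsub>G\<^esub>) \<otimes>\<^bsub>G\<^esub> y [^]\<^bsub>G\<^esub> c"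
    for a :: 'g and c :: nat and b :: bool and y
  have fcont: "continuous_map T T (f a c b)" if "a \<in> carrier G" for a c b
    unfolding f_def using that by (intro continuous_map_step[OF TG]) auto
  define P where "P n s \<longleftrightarrow> (case s of (g :: 'g, k :: nat, U, \<Phi>) \<Rightarrow>
      openin T U \<and> \<one>\<^bsub>G\<^esub> \<in> U \<and> Q n \<Phi> U \<and> finite \<Phi> \<and> (\<forall>h\<in>\<Phi>. continuous_map T T h) \<and> (\<lambda>x. x) \<in> \<Phi>)"
    for n s
  \<comment> \<open>\<open>R\<close> links consecutive stages: the element and the exponent stored
    at a stage belong to the step from that stage back to the previous one.\<close>
  define R where "R s s' \<longleftrightarrow> (case s of (g :: 'g, k :: nat, U, \<Phi> :: ('g \<Rightarrow> 'g) set) \<Rightarrow> case s' of (g', k', U', \<Phi>' :: ('g \<Rightarrow> 'g) set) \<Rightarrow>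
      g' \<in> carrier G \<and> 0 < k' \<and> (\<forall>b\<in>carrier A. b [^] k' \<noteq> \<phi> g') \<and>
      (\<forall>b. \<forall>y\<in>U'. f g' k' b y \<in> U) \<and> (\<forall>h\<in>\<Phi>. \<forall>b. h \<circ> f g' k' b \<in> \<Phi>'))"
    for s s'
  have init: "\<exists>s. P 0 s"
  proof -
    obtain U where "openin T U" "\<one>\<^bsub>G\<^esub> \<in> U" "Q 0 {\<lambda>x. x} U"
      using Qex[of "{\<lambda>x. x}" 0] by auto
    then have "P 0 (undefined, 0, U, {\<lambda>x. x})" unfolding P_def by auto
    then show ?thesis by blast
  qed
  have ext: "\<exists>s'. P (Suc n) s' \<and> R s s'" if s: "P n s" for n s
  proof -
    obtain g k U \<Phi> where seq: "s = (g, k, U, \<Phi>)" by (cases s) auto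
    have U: "openin T U" "\<one>\<^bsub>G\<^esub> \<in> U" and fin: "finite \<Phi>"
      and cont: "\<And>h. h \<in> \<Phi> \<Longrightarrow> continuous_map T T h"
      using s unfolding P_def seq by auto
    obtain g' where g': "g' \<in> U" "\<phi> g' \<noteq> \<one>" using nbhd U by blast
    have g'c: "g' \<in> carrier G" using g' U ts openin_subset by blast
    obtain k' :: nat where k': "0 < k'" "\<forall>b\<in>carrier A. b [^] k' \<noteq> \<phi> g'"
      using bspec[OF red[unfolded no_divisible_elem_def], of "\<phi> g'"] g'(2) g'c by auto
    define \<Phi>' where "\<Phi>' = insert (\<lambda>x. x) (\<Union>b. (\<lambda>h. h \<circ> f g' k' b) ` \<Phi>)"
    have "finite \<Phi>'" unfolding \<Phi>'_def using fin by auto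
    moreover have cont': "continuous_map T T h" if "h \<in> \<Phi>'" for h
      using that cont fcont[OF g'c] unfolding \<Phi>'_def by (auto intro: continuous_map_compose)
    ultimately obtain U1 where U1: "openin T U1" "\<one>\<^bsub>G\<^esub> \<in> U1" "Q (Suc n) \<Phi>' U1"
      using Qex by blast
    \<comment> \<open>Both \<open>g'\<close> and the identity lie in \<open>U\<close>, so for either
      bit the preimage of \<open>U\<close> is a neighbourhood of the identity.\<close>
    define V where "V b = {y \<in> topspace T. f g' k' b y \<in> U}" for b
    have V: "openin T (V b)" "\<one>\<^bsub>G\<^esub> \<in> V b" for b
    proof -
      show "openin T (V b)"
        unfolding V_def using fcont[OF g'c] U(1) by (rule openin_continuous_map_preimage)
      show "\<one>\<^bsub>G\<^esub> \<in> V b" unfolding V_def using U g' g'c by (simp add: ts f_def)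
    qed
    define U' where "U' = U1 \<inter> V True \<inter> V False"
    have "P (Suc n) (g', k', U', \<Phi>')"
      unfolding P_def U'_def
      using U1 V \<open>finite \<Phi>'\<close> cont' Qmono[OF U1(3), of "U1 \<inter> V True \<inter> V False"]
      by (auto simp: \<Phi>'_def)
    moreover have "f g' k' b y \<in> U" if "y \<in> U'" for b y
      using that unfolding U'_def V_def by (cases b) auto
    then have "R s (g', k', U', \<Phi>')"
      unfolding R_def seq using g'c k' by (auto simp: \<Phi>'_def)
    ultimately show ?thesis by blast
  qed
  obtain s where s: "\<And>n. P n (s n)" "\<And>n. R (s n) (s (Suc n))"
  proof -
    have "\<exists>s. \<forall>n. P n (s n) \<and> R (s n) (s (Suc n))"
      by (rule dependent_nat_choice) (use init ext in auto)
    then show ?thesis using that by blast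
  qed
  \<comment> \<open>The index shifts because the pair for step \<open>n\<close> is stored at stage
    \<open>Suc n\<close>; the pair put into stage 0 is a placeholder.\<close>
  define g where "g n = fst (s (Suc n))" for n
  define k where "k n = fst (snd (s (Suc n)))" for n
  define U where "U n = fst (snd (snd (s n)))" for n
  define \<Phi> where "\<Phi> n = snd (snd (snd (s n)))" for n
  have step: "step G g k e n = f (g n) (k n) (e n)" for e n
    unfolding step_def f_def by auto
  have P: "openin T (U n) \<and> \<one>\<^bsub>G\<^esub> \<in> U n \<and> Q n (\<Phi> n) (U n) \<and> (\<lambda>x. x) \<in> \<Phi> n" for n
    using s(1)[of n] unfolding P_def U_def \<Phi>_def by (auto simp: case_prod_beta)
  have R: "g n \<in> carrier G \<and> 0 < k n \<and> (\<forall>b\<in>carrier A. b [^] k n \<noteq> \<phi> (g n)) \<and>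
      (\<forall>b. \<forall>y\<in>U (Suc n). f (g n) (k n) b y \<in> U n) \<and> (\<forall>h\<in>\<Phi> n. \<forall>b. h \<circ> f (g n) (k n) b \<in> \<Phi> (Suc n))" for n
    using s(2)[of n] unfolding R_def U_def \<Phi>_def g_def k_def by (auto simp: case_prod_beta)
  show ?thesis
  proof (rule that[of g k U \<Phi>])
    show "range g \<subseteq> carrier G" using R by blast
    show "step G g k e n y \<in> U n" if "y \<in> U (Suc n)" for e n y
      unfolding step using R that by blast
    show "h \<circ> step G g k e n \<in> \<Phi> (Suc n)" if "h \<in> \<Phi> n" for n h e
      unfolding step using R that by blast
    show "0 < k n" for n using R by blast
    show "b [^] k n \<noteq> \<phi> (g n)" if "b \<in> carrier A" for n b using R that by blast
    show "openin T (U n)" "\<one>\<^bsub>G\<^esub> \<in> U n" "Q n (\<Phi> n) (U n)" "(\<lambda>x. x) \<in> \<Phi> n" for n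
      using P by blast+
  qed
qed

text \<open>Applying \<open>\<phi>\<close> carries solutions in \<open>G\<close> to solutions in
  \<open>A\<close>, where \<open>nest_coding\<close> rules them out.\<close>

lemma (in small_tf_reduced_group) no_coded_solutions:
  fixes G :: "('g, 'm) monoid_scheme"
  assumes "group G" "\<phi> \<in> hom G A" "range g \<subseteq> carrier G" "\<And>n. 0 < k n"
    "\<And>n b. b \<in> carrier A \<Longrightarrow> b [^] k n \<noteq> \<phi> (g n)"
    and sol: "\<And>e. \<exists>x\<in>carrier G. \<forall>n. \<exists>y\<in>carrier G. x = nest G g k e n y"
  shows False
proof -
  interpret G: group G by fact
  interpret \<phi>: group_hom G A \<phi> by (unfold_locales) fact
  show False
  proof (rule nest_coding[of "\<phi> \<circ> g" k])
    show "\<exists>b\<in>carrier A. \<forall>n. \<exists>y\<in>carrier A. b = nest A (\<phi> \<circ> g) k e n y" for e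
    proof -
      obtain x where x: "x \<in> carrier G" "\<And>n. \<exists>y\<in>carrier G. x = nest G g k e n y"
        using sol by blast
      have "\<exists>y\<in>carrier A. \<phi> x = nest A (\<phi> \<circ> g) k e n y" for n
      proof -
        obtain y where y: "y \<in> carrier G" "x = nest G g k e n y" using x(2) by blast
        show ?thesis
          using \<phi>.hom_nest[OF assms(3) y(1), of k e n] y by (intro bexI[of _ "\<phi> y"]) auto
      qed
      then show ?thesis using \<phi>.hom_closed[OF x(1)] by blast
    qed
    show "range (\<phi> \<circ> g) \<subseteq> carrier A" using assms(3) by auto
  qed (use assms(4,5) in simp_all)
qed

text \<open>The closures of the \<open>U n\<close> are compact and each step maps one into the
  previous, so their images under \<open>nest\<close> are nested nonempty compact sets. A common
  point solves the system for the given bits.\<close>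

lemma (in small_tf_reduced_group) locally_compact_open_kernel:
  fixes G :: "('g, 'm) monoid_scheme"
  assumes TG: "topological_group G T" and \<phi>: "\<phi> \<in> hom G A"
    and lc: "locally_compact_space T" and H: "Hausdorff_space T"
  shows "openin T (kernel G A \<phi>)"
proof (rule ccontr)
  assume nopen: "\<not> ?thesis"
  interpret G: group G using TG unfolding topological_group_def by blast
  have ts: "topspace T = carrier G" using TG unfolding topological_group_def by auto
  define Q where "Q n \<Phi> U \<longleftrightarrow> (\<exists>K. compactin T K \<and> U \<subseteq> K)"
    for n :: nat and \<Phi> :: "('g \<Rightarrow> 'g) set" and U
  obtain g k U \<Phi> where g: "range g \<subseteq> carrier G" and k: "\<And>n. 0 < k n"
    and ndiv: "\<And>n b. b \<in> carrier A \<Longrightarrow> b [^] k n \<noteq> \<phi> (g n)"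
    and U: "\<And>n. openin T (U n)" "\<And>n. \<one>\<^bsub>G\<^esub> \<in> U n"
    and stepU: "\<And>e n y. y \<in> U (Suc n) \<Longrightarrow> step G g k e n y \<in> U n"
    and Q: "\<And>n. Q n (\<Phi> n) (U n)"
  proof (rule exists_step_sequence[OF TG \<phi> nopen, of Q])
    show "\<exists>U. openin T U \<and> \<one>\<^bsub>G\<^esub> \<in> U \<and> Q n \<Phi> U" for n \<Phi>
      using lc unfolding locally_compact_space_def Q_def by (metis G.one_closed ts)
    show "Q n \<Phi> V" if "Q n \<Phi> U" "V \<subseteq> U" for n \<Phi> U V
      using that unfolding Q_def by blast
  qed (use that in blast)
  \<comment> \<open>Each \<open>U n\<close> lies in a compact set, which is closed because
    \<open>T\<close> is Hausdorff; hence the closure of \<open>U n\<close> is compact.\<close>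
  define C where "C n = T closure_of U n" for n
  have compC: "compactin T (C n)" for n
  proof -
    obtain K where K: "compactin T K" "U n \<subseteq> K" using Q unfolding Q_def by blast
    then have "C n \<subseteq> K"
      unfolding C_def using H by (simp add: closure_of_minimal compactin_imp_closedin)
    then show ?thesis using K closed_compactin unfolding C_def by (metis closedin_closure_of)
  qed
  have stepcont: "continuous_map T T (step G g k e n)" for e n
    unfolding step_def using g by (intro continuous_map_step[OF TG]) auto
  have stepC: "step G g k e n ` C (Suc n) \<subseteq> C n" for e n
    unfolding C_def
    using continuous_map_image_closure_subset[OF stepcont] closure_of_mono[of _ "U n" T] stepU
    by (meson image_subsetI order_trans)
  have nestcont: "continuous_map T T (nest G g k e n)" for e n
  proof (induction n)
    case (Suc n)
    have "nest G g k e (Suc n) = nest G g k e n \<circ> step G g k e n" by (auto simp: fun_eq_iff)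
    then show ?case using Suc stepcont continuous_map_compose by metis
  qed (auto simp: ts)
  have "\<exists>x\<in>carrier G. \<forall>n. \<exists>y\<in>carrier G. x = nest G g k e n y" for e
  proof -
    define K where "K n = nest G g k e n ` C n" for n
    have dec: "K (Suc n) \<subseteq> K n" for n unfolding K_def using stepC[of e n] by fastforce
    have comp: "compactin T (K n)" for n
      unfolding K_def using compC nestcont image_compactin by blast
    have ne: "K n \<noteq> {}" for n
    proof -
      have "\<one>\<^bsub>G\<^esub> \<in> C n" using U openin_subset closure_of_subset unfolding C_def by (metis subsetD)
      then show ?thesis unfolding K_def by blast
    qed
    have sub: "K n \<subseteq> K 0" for n using dec by (induction n) auto
    have "(\<Inter>n. K n) \<noteq> {}"
    proof (rule compact_space_imp_nest)
      show "compact_space (subtopology T (K 0))" using comp compact_space_subtopology by blast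
      show "closedin (subtopology T (K 0)) (K n)" for n
        using comp[of n] sub[of n] H compactin_imp_closedin closedin_subset_topspace by blast
      show "decseq K" using dec by (simp add: decseq_SucI)
    qed (use ne in auto)
    then obtain x where x: "\<And>n. x \<in> K n" by blast
    have Csub: "C n \<subseteq> carrier G" for n using closure_of_subset_topspace ts unfolding C_def by metis
    show ?thesis
    proof (rule bexI[of _ x], rule allI)
      show "x \<in> carrier G" using x[of 0] Csub unfolding K_def by auto
      show "\<exists>y\<in>carrier G. x = nest G g k e n y" for n using x[of n] Csub unfolding K_def by blast
    qed
  qed
  then show False using no_coded_solutions[OF G.is_group \<phi> g k ndiv] by blast
qed

text \<open>Cutting the system off after finitely many steps gives approximate solutions. They are
  Cauchy because everything after stage \<open>n + m\<close> stays in \<open>U (n + m)\<close>,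
  whose image under the preceding steps is small; continuity makes the limits solve the system
  exactly.\<close>

lemma (in small_tf_reduced_group) completely_metrizable_open_kernel:
  fixes G :: "('g, 'm) monoid_scheme"
  assumes TG: "topological_group G T" and \<phi>: "\<phi> \<in> hom G A"
    and cm: "completely_metrizable_space T"
  shows "openin T (kernel G A \<phi>)"
proof (rule ccontr)
  assume nopen: "\<not> ?thesis"
  interpret G: group G using TG unfolding topological_group_def by blast
  have ts: "topspace T = carrier G" using TG unfolding topological_group_def by auto
  obtain M d where "Metric_space M d" and complete: "Metric_space.mcomplete M d"
    and T: "T = Metric_space.mtopology M d"
    using cm unfolding completely_metrizable_space_def by blast
  then interpret M: Metric_space M d by blast
  have M: "M = carrier G" using ts unfolding T by simp
  \<comment> \<open>The metric need not be invariant under translation, so the images of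
    \<open>U\<close> under all composed steps have to be small, not only \<open>U\<close>
    itself.\<close>
  define Q where "Q n \<Phi> U \<longleftrightarrow> (\<forall>h\<in>\<Phi>. \<forall>x\<in>U. \<forall>y\<in>U. d (h x) (h y) < (1/2)^n)"
    for n :: nat and \<Phi> :: "('g \<Rightarrow> 'g) set" and U
  obtain g k U \<Phi> where g: "range g \<subseteq> carrier G" and k: "\<And>n. 0 < k n"
    and ndiv: "\<And>n b. b \<in> carrier A \<Longrightarrow> b [^] k n \<noteq> \<phi> (g n)"
    and U: "\<And>n. openin T (U n)" "\<And>n. \<one>\<^bsub>G\<^esub> \<in> U n"
    and stepU: "\<And>e n y. y \<in> U (Suc n) \<Longrightarrow> step G g k e n y \<in> U n"
    and Q: "\<And>n. Q n (\<Phi> n) (U n)"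
    and id\<Phi>: "\<And>n. (\<lambda>x. x) \<in> \<Phi> n"
    and step\<Phi>: "\<And>n h e. h \<in> \<Phi> n \<Longrightarrow> h \<circ> step G g k e n \<in> \<Phi> (Suc n)"
  proof (rule exists_step_sequence[OF TG \<phi> nopen, of Q])
    show "\<exists>U. openin T U \<and> \<one>\<^bsub>G\<^esub> \<in> U \<and> Q n \<Phi> U"
      if fin: "finite \<Phi>" and cont: "\<And>h. h \<in> \<Phi> \<Longrightarrow> continuous_map T T h" for n \<Phi>
    proof -
      define V where "V h = {x \<in> topspace T. h x \<in> M.mball (h \<one>\<^bsub>G\<^esub>) ((1/2)^n / 2)}" for h
      have V: "openin T (V h)" "\<one>\<^bsub>G\<^esub> \<in> V h" if "h \<in> \<Phi>" for h
      proof -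
        have "h \<one>\<^bsub>G\<^esub> \<in> M" using cont[OF that] ts M by (metis G.one_closed continuous_map_image_subset_topspace image_subset_iff)
        then show "openin T (V h)" and "\<one>\<^bsub>G\<^esub> \<in> V h"
        proof -
          assume h1: "h \<one>\<^bsub>G\<^esub> \<in> M"
          have "openin T (M.mball (h \<one>\<^bsub>G\<^esub>) ((1/2)^n / 2))" unfolding T by (rule M.openin_mball)
          with cont[OF that] show "openin T (V h)"
            unfolding V_def by (rule openin_continuous_map_preimage)
          show "\<one>\<^bsub>G\<^esub> \<in> V h" unfolding V_def using h1 by (simp add: ts)
        qed
      qed
      have "d (h x) (h y) < (1/2)^n" if "h \<in> \<Phi>" "x \<in> V h" "y \<in> V h" for h x y
      proof -
        have "d (h x) (h y) \<le> d (h x) (h \<one>\<^bsub>G\<^esub>) + d (h \<one>\<^bsub>G\<^esub>) (h y)"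
          using that unfolding V_def by (intro M.triangle) auto
        also have "\<dots> < (1/2)^n / 2 + (1/2)^n / 2"
          using that unfolding V_def by (intro add_strict_mono) (auto simp: M.commute)
        finally show ?thesis by simp
      qed
      then have "Q n \<Phi> (topspace T \<inter> \<Inter>(V ` \<Phi>))" unfolding Q_def by auto
      moreover have "openin T (topspace T \<inter> \<Inter>(V ` \<Phi>))"
        using openin_INT[OF fin, of T V] V(1) by (simp add: Int_commute)
      ultimately show ?thesis using V(2) by (intro exI[of _ "topspace T \<inter> \<Inter>(V ` \<Phi>)"]) (auto simp: ts)
    qed
    show "Q n \<Phi> V" if "Q n \<Phi> U" "V \<subseteq> U" for n \<Phi> U V
      using that unfolding Q_def by blast
  qed (use that in blast)
  have stepcont: "continuous_map T T (step G g k e n)" for e n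
    unfolding step_def using g by (intro continuous_map_step[OF TG]) auto
  have "\<exists>x\<in>carrier G. \<forall>n. \<exists>y\<in>carrier G. x = nest G g k e n y" for e
  proof -
    \<comment> \<open>\<open>F m n\<close> performs the \<open>m\<close> steps from stage
      \<open>n\<close> on, starting innermost from the identity.\<close>
    define F where "F = rec_nat (\<lambda>n. \<one>\<^bsub>G\<^esub>) (\<lambda>m Fm n. step G g k e n (Fm (Suc n)))"
    have F0: "F 0 n = \<one>\<^bsub>G\<^esub>" and FS: "F (Suc m) n = step G g k e n (F m (Suc n))" for m n
      unfolding F_def by auto
    have FU: "F m n \<in> U n" for m n
      by (induction m arbitrary: n) (auto simp: F0 FS U stepU)
    have Fc: "F m n \<in> carrier G" for m n using FU U(1) ts openin_subset by blast
    \<comment> \<open>One map \<open>h\<close> performs the first \<open>m\<close> steps for all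
      \<open>j\<close>, so \<open>Q\<close> bounds the distance between any two
      continuations.\<close>
    have H: "\<exists>h\<in>\<Phi> (n + m). \<forall>j. F (m + j) n = h (F j (n + m))" for m n
    proof (induction m)
      case 0
      show ?case using id\<Phi> by (intro bexI[of _ "\<lambda>x. x"]) auto
    next
      case (Suc m)
      then obtain h where h: "h \<in> \<Phi> (n + m)" "\<And>j. F (m + j) n = h (F j (n + m))" by blast
      show ?case
      proof (intro bexI[of _ "h \<circ> step G g k e (n + m)"] allI)
        show "F (Suc m + j) n = (h \<circ> step G g k e (n + m)) (F j (n + Suc m))" for j
          using h(2)[of "Suc j"] by (simp add: FS)
        show "h \<circ> step G g k e (n + m) \<in> \<Phi> (n + Suc m)" using step\<Phi>[OF h(1)] by simp
      qed
    qed
    have near: "d (F (m + i) n) (F (m + j) n) < (1/2)^m" for m n i j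
    proof -
      obtain h where h: "h \<in> \<Phi> (n + m)" "\<And>j. F (m + j) n = h (F j (n + m))"
        using H by blast
      have "d (F (m + i) n) (F (m + j) n) < (1/2)^(n + m)"
        using Q[of "n + m"] h(1) FU unfolding Q_def h(2) by blast
      also have "\<dots> \<le> (1/2)^m" by (rule power_decreasing) auto
      finally show ?thesis .
    qed
    have "M.MCauchy (\<lambda>m. F m n)" for n
      unfolding M.MCauchy_def
    proof (intro conjI allI impI)
      show "range (\<lambda>m. F m n) \<subseteq> M" using Fc M by auto
      fix \<epsilon> :: real assume "\<epsilon> > 0"
      then obtain N where N: "(1/2)^N < \<epsilon>" using real_arch_pow_inv[of \<epsilon> "1/2"] by auto
      show "\<exists>N. \<forall>i j. N \<le> i \<longrightarrow> N \<le> j \<longrightarrow> d (F i n) (F j n) < \<epsilon>"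
      proof (intro exI[of _ N] allI impI)
        fix i j assume "N \<le> i" "N \<le> j"
        then show "d (F i n) (F j n) < \<epsilon>" using near[of N "i - N" n "j - N"] N by simp
      qed
    qed
    then have "\<exists>b. limitin T (\<lambda>m. F m n) b sequentially" for n
      using complete unfolding M.mcomplete_def T by blast
    then obtain b where b: "\<And>n. limitin T (\<lambda>m. F m n) (b n) sequentially" by metis
    have bc: "b n \<in> carrier G" for n using b limitin_topspace ts by metis
    \<comment> \<open>Dropping the first approximation does not change the limit, and a step passes
      to the limit by continuity; limits are unique.\<close>
    have bstep: "b n = step G g k e n (b (Suc n))" for n
    proof (rule limitin_Hausdorff_unique)
      show "limitin T (\<lambda>m. F (Suc m) n) (b n) sequentially"
        using limitin_sequentially_offset[OF b[of n], of 1] by simp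
      show "limitin T (\<lambda>m. F (Suc m) n) (step G g k e n (b (Suc n))) sequentially"
        using continuous_map_limit[OF stepcont b] by (simp add: FS o_def)
      show "Hausdorff_space T" unfolding T by (rule M.Hausdorff_space_mtopology)
    qed auto
    have "b 0 = nest G g k e n (b n)" for n
    proof (induction n)
      case (Suc n)
      have "b 0 = nest G g k e n (b n)" by (rule Suc)
      also have "\<dots> = nest G g k e (Suc n) (b (Suc n))" by (subst bstep) simp
      finally show ?case .
    qed simp
    then show ?thesis using bc by blast
  qed
  then show False using no_coded_solutions[OF G.is_group \<phi> g k ndiv] by blast
qed

section \<open>Geometry of the Hawaiian earring\<close>

text \<open>Expanding the equation of the circle cancels the constant term. The result is linear in
  \<open>n\<close>, so off the origin the index of the circle through a point is the ratio of twice
  the height to the squared norm.\<close>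

lemma HE_circle_iff:
  assumes "1 \<le> n"
  shows "z \<in> HE_circle n \<longleftrightarrow> real n * ((fst z)\<^sup>2 + (snd z)\<^sup>2) = 2 * snd z"
proof -
  obtain x y where z: "z = (x, y)" by (cases z)
  have n: "real n > 0" using assms by simp
  have "z \<in> HE_circle n \<longleftrightarrow> sqrt (x\<^sup>2 + (1 / real n - y)\<^sup>2) = 1 / real n"
    unfolding HE_circle_def z by (simp add: dist_Pair_Pair dist_real_def)
  also have "\<dots> \<longleftrightarrow> x\<^sup>2 + (1 / real n - y)\<^sup>2 = (1 / real n)\<^sup>2"
  proof -
    have "sqrt ((1 / real n)\<^sup>2) = 1 / real n" using n by simp
    then show ?thesis using real_sqrt_eq_iff[of "x\<^sup>2 + (1 / real n - y)\<^sup>2" "(1 / real n)\<^sup>2"] by simp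
  qed
  also have "\<dots> \<longleftrightarrow> real n * (x\<^sup>2 + y\<^sup>2) = 2 * y"
  proof -
    have "x\<^sup>2 + (1 / real n - y)\<^sup>2 = (1 / real n)\<^sup>2 + (real n * (x\<^sup>2 + y\<^sup>2) - 2 * y) / real n"
      using n by (simp add: power2_diff diff_divide_distrib)
    then show ?thesis using n by simp
  qed
  finally show ?thesis by (simp add: z)
qed

lemma norm_sq_prod: "(norm (z :: real \<times> real))\<^sup>2 = (fst z)\<^sup>2 + (snd z)\<^sup>2"
  by (cases z) (simp add: norm_Pair)

lemma sq_sum_pos: "z \<noteq> 0 \<Longrightarrow> 0 < (fst z)\<^sup>2 + (snd z :: real)\<^sup>2"
  unfolding norm_sq_prod[symmetric] by simp

lemma HE_E:
  assumes "z \<in> hawaiian_earring"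
  obtains n :: nat where "1 \<le> n" "z \<in> HE_circle n" "real n * ((fst z)\<^sup>2 + (snd z)\<^sup>2) = 2 * snd z"
  using assms that unfolding hawaiian_earring_def by (auto simp: HE_circle_iff)

lemma HE_I:
  assumes "1 \<le> n" "real n * ((fst z)\<^sup>2 + (snd z)\<^sup>2) = 2 * snd z"
  shows "z \<in> hawaiian_earring"
  using assms HE_circle_iff[OF assms(1), of z] unfolding hawaiian_earring_def by auto

lemma zero_in_HE: "0 \<in> hawaiian_earring"
  by (rule HE_I[of 1]) auto

text \<open>Off the origin the inequality says that the index of the circle is at most
  \<open>N\<close>. In this form the origin is included for every \<open>N\<close> and closedness
  reduces to that of the earring; \<open>HE_inner N\<close> treats the indices above
  \<open>N\<close> in the same way.\<close>

definition HE_outer :: "nat \<Rightarrow> (real \<times> real) set" where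
  "HE_outer N = {z \<in> hawaiian_earring. 2 * snd z \<le> real N * ((fst z)\<^sup>2 + (snd z)\<^sup>2)}"

definition HE_inner :: "nat \<Rightarrow> (real \<times> real) set" where
  "HE_inner N = {z \<in> hawaiian_earring. real (Suc N) * ((fst z)\<^sup>2 + (snd z)\<^sup>2) \<le> 2 * snd z}"

lemma HE_outer_iff: "z \<in> HE_outer N \<longleftrightarrow> z = 0 \<or> (\<exists>n\<in>{1..N}. z \<in> HE_circle n)"
proof (cases "z = 0")
  case False
  then have r: "0 < (fst z)\<^sup>2 + (snd z)\<^sup>2" by (rule sq_sum_pos)
  show ?thesis
  proof
    assume "z \<in> HE_outer N"
    then obtain n where n: "1 \<le> n" "z \<in> HE_circle n" "real n * ((fst z)\<^sup>2 + (snd z)\<^sup>2) = 2 * snd z"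
      and "2 * snd z \<le> real N * ((fst z)\<^sup>2 + (snd z)\<^sup>2)"
      unfolding HE_outer_def by (blast elim: HE_E)
    then have "real n * ((fst z)\<^sup>2 + (snd z)\<^sup>2) \<le> real N * ((fst z)\<^sup>2 + (snd z)\<^sup>2)" by simp
    then have "real n \<le> real N" using r by simp
    then show "z = 0 \<or> (\<exists>n\<in>{1..N}. z \<in> HE_circle n)" using n by auto
  next
    assume "z = 0 \<or> (\<exists>n\<in>{1..N}. z \<in> HE_circle n)"
    then obtain n where n: "1 \<le> n" "n \<le> N" "z \<in> HE_circle n" using False by auto
    then have e: "real n * ((fst z)\<^sup>2 + (snd z)\<^sup>2) = 2 * snd z" using HE_circle_iff by blast
    moreover have "real n * ((fst z)\<^sup>2 + (snd z)\<^sup>2) \<le> real N * ((fst z)\<^sup>2 + (snd z)\<^sup>2)"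
      using r n by (intro mult_right_mono) auto
    ultimately show "z \<in> HE_outer N" unfolding HE_outer_def using HE_I[OF n(1) e] by simp
  qed
qed (simp add: HE_outer_def zero_in_HE)

lemma HE_outer_Un_inner: "HE_outer N \<union> HE_inner N = hawaiian_earring"
proof -
  have "z \<in> HE_inner N" if "z \<in> hawaiian_earring" "z \<notin> HE_outer N" for z
  proof -
    obtain n where n: "1 \<le> n" "z \<in> HE_circle n" "real n * ((fst z)\<^sup>2 + (snd z)\<^sup>2) = 2 * snd z"
      using \<open>z \<in> hawaiian_earring\<close> by (rule HE_E)
    then have "Suc N \<le> n" using that HE_outer_iff[of z N] by (metis Suc_leI atLeastAtMost_iff not_le)
    then have "real (Suc N) * ((fst z)\<^sup>2 + (snd z)\<^sup>2) \<le> real n * ((fst z)\<^sup>2 + (snd z)\<^sup>2)"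
      by (intro mult_right_mono) auto
    then show ?thesis unfolding HE_inner_def using that n by simp
  qed
  then show ?thesis unfolding HE_outer_def HE_inner_def by blast
qed

lemma HE_outer_Int_inner: "HE_outer N \<inter> HE_inner N = {0}"
proof -
  have "z = 0" if "z \<in> HE_outer N" "z \<in> HE_inner N" for z
  proof (rule ccontr)
    assume "z \<noteq> 0"
    then have "0 < (fst z)\<^sup>2 + (snd z)\<^sup>2" by (rule sq_sum_pos)
    then have "real N * ((fst z)\<^sup>2 + (snd z)\<^sup>2) < real (Suc N) * ((fst z)\<^sup>2 + (snd z)\<^sup>2)" by simp
    then show False using that unfolding HE_outer_def HE_inner_def by simp
  qed
  then show ?thesis by (auto simp: HE_outer_def HE_inner_def zero_in_HE)
qed

lemma norm_HE_inner:
  assumes "z \<in> HE_inner N"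
  shows "norm z \<le> 2 / real (Suc N)"
proof (cases "z = 0")
  case False
  have "real (Suc N) * (norm z)\<^sup>2 \<le> 2 * snd z"
    using assms unfolding HE_inner_def norm_sq_prod by simp
  also have "\<dots> \<le> 2 * norm z"
    using norm_snd_le[of "snd z" "fst z"] by simp
  finally have "real (Suc N) * norm z \<le> 2"
    using False by (simp add: power2_eq_square mult.assoc[symmetric])
  then show ?thesis by (simp add: field_simps)
qed simp

lemma closed_HE_circle: "closed (HE_circle n)"
  unfolding HE_circle_def by simp

text \<open>The circles beyond the first \<open>N\<close> lie in a disc whose radius tends to zero,
  so the infinite union is an intersection of closed sets, each a finite union of circles enlarged
  by a disc.\<close>

lemma closed_HE: "closed hawaiian_earring"
proof -
  have "hawaiian_earring = (\<Inter>N. (\<Union>n\<in>{1..N}. HE_circle n) \<union> cball 0 (2 / real (Suc N)))" (is "_ = ?R")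
  proof
    show "hawaiian_earring \<subseteq> ?R"
    proof (intro subsetI INT_I)
      fix z N assume "z \<in> hawaiian_earring"
      then have "z \<in> HE_outer N \<or> z \<in> HE_inner N" using HE_outer_Un_inner by blast
      then show "z \<in> (\<Union>n\<in>{1..N}. HE_circle n) \<union> cball 0 (2 / real (Suc N))"
      proof
        assume "z \<in> HE_outer N"
        then show ?thesis unfolding HE_outer_iff by auto
      next
        assume "z \<in> HE_inner N"
        then show ?thesis using norm_HE_inner by auto
      qed
    qed
    show "?R \<subseteq> hawaiian_earring"
    proof
      fix z assume z: "z \<in> ?R"
      show "z \<in> hawaiian_earring"
      proof (cases "z = 0")
        case False
        then obtain N where "inverse (real (Suc N)) < norm z / 2"
          using reals_Archimedean[of "norm z / 2"] by auto
        then have "z \<notin> cball 0 (2 / real (Suc N))" by (simp add: field_simps)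
        then have "z \<in> (\<Union>n\<in>{1..N}. HE_circle n)" using z by blast
        then show ?thesis unfolding hawaiian_earring_def by auto
      qed (simp add: zero_in_HE)
    qed
  qed
  moreover have "closed ?R"
    using closed_HE_circle by (intro closed_INT closed_Un closed_UN ballI) auto
  ultimately show ?thesis by simp
qed

lemma closed_HE_outer: "closed (HE_outer N)"
proof -
  have "HE_outer N = hawaiian_earring \<inter> {z. 2 * snd z \<le> real N * ((fst z)\<^sup>2 + (snd z)\<^sup>2)}"
    unfolding HE_outer_def by auto
  moreover have "closed {z :: real \<times> real. 2 * snd z \<le> real N * ((fst z)\<^sup>2 + (snd z)\<^sup>2)}"
    by (intro closed_Collect_le continuous_intros)
  ultimately show ?thesis using closed_HE by auto
qed

lemma closed_HE_inner: "closed (HE_inner N)"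
proof -
  have "HE_inner N = hawaiian_earring \<inter> {z. real (Suc N) * ((fst z)\<^sup>2 + (snd z)\<^sup>2) \<le> 2 * snd z}"
    unfolding HE_inner_def by auto
  moreover have "closed {z :: real \<times> real. real (Suc N) * ((fst z)\<^sup>2 + (snd z)\<^sup>2) \<le> 2 * snd z}"
    by (intro closed_Collect_le continuous_intros)
  ultimately show ?thesis using closed_HE by auto
qed

section \<open>Retractions onto the outer and the inner circles\<close>

definition collapse_onto :: "(real \<times> real) set \<Rightarrow> real \<times> real \<Rightarrow> real \<times> real" where
  "collapse_onto S z = (if z \<in> S then z else 0)"

lemma continuous_on_collapse_outer: "continuous_on hawaiian_earring (collapse_onto (HE_outer N))"
proof -
  have "continuous_on (HE_outer N \<union> HE_inner N) (\<lambda>z. if z \<in> HE_outer N then z else 0)"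
    by (rule continuous_on_cases[OF closed_HE_outer closed_HE_inner])
       (use HE_outer_Int_inner in \<open>auto intro: continuous_intros\<close>)
  then show ?thesis unfolding HE_outer_Un_inner collapse_onto_def[abs_def] .
qed

lemma continuous_on_collapse_inner: "continuous_on hawaiian_earring (collapse_onto (HE_inner N))"
proof -
  have "continuous_on (HE_inner N \<union> HE_outer N) (\<lambda>z. if z \<in> HE_inner N then z else 0)"
    by (rule continuous_on_cases[OF closed_HE_inner closed_HE_outer])
       (use HE_outer_Int_inner in \<open>auto intro: continuous_intros\<close>)
  moreover have "HE_inner N \<union> HE_outer N = hawaiian_earring" using HE_outer_Un_inner by auto
  ultimately show ?thesis unfolding collapse_onto_def[abs_def] by simp
qed

text \<open>The two conditions can differ only at the origin, which belongs to
  \<open>HE_outer 0\<close> but not to an empty union of circles, and both maps fix it.\<close>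

lemma HE_retract_eq: "HE_retract N z = collapse_onto (HE_outer N) z"
  unfolding HE_retract_def collapse_onto_def using HE_outer_iff[of z N] by (auto simp: zero_prod_def)

text \<open>Inversion in the unit circle turns the \<open>n\<close>-th circle into the line \<open>y = n / 2\<close>. In these
  coordinates the map is \<open>(s, n / 2) \<mapsto> (s / l, n / 2)\<close> with \<open>l = max 0 (1 - t * \<bar>s\<bar>)\<close>.\<close>

definition shrink :: "real \<Rightarrow> real \<times> real \<Rightarrow> real \<times> real" where
  "shrink t z = (let r = (fst z)\<^sup>2 + (snd z)\<^sup>2; l = max 0 (1 - t * (\<bar>fst z\<bar> / r)) in
     (r / ((fst z)\<^sup>2 + l\<^sup>2 * (snd z)\<^sup>2)) *\<^sub>R (l * fst z, l\<^sup>2 * snd z))"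

section \<open>Shrinking preserves the circles and is continuous\<close>

lemma shrink_zero [simp]: "shrink t 0 = 0"
  unfolding shrink_def by (simp add: zero_prod_def)

lemma shrink_0: "shrink 0 z = z"
proof (cases "z = 0")
  case False
  then show ?thesis using sq_sum_pos[OF False]
    by (cases z) (simp add: shrink_def Let_def)
qed simp

lemma shrink_denom:
  assumes "z \<noteq> 0"
  shows "0 < (fst z)\<^sup>2 + (max 0 (1 - t * (\<bar>fst z\<bar> / ((fst z)\<^sup>2 + (snd z)\<^sup>2))))\<^sup>2 * (snd z :: real)\<^sup>2"
proof (cases "fst z = 0")
  case True
  then show ?thesis using assms by (auto simp: prod_eq_iff)
next
  case False
  then show ?thesis by (intro add_pos_nonneg) auto
qed

lemma shrink_sq:
  fixes z :: "real \<times> real" and t :: real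
  assumes "z \<noteq> 0"
  defines "r \<equiv> (fst z)\<^sup>2 + (snd z)\<^sup>2"
  defines "l \<equiv> max 0 (1 - t * (\<bar>fst z\<bar> / r))"
  defines "D \<equiv> (fst z)\<^sup>2 + l\<^sup>2 * (snd z)\<^sup>2"
  shows "(fst (shrink t z))\<^sup>2 + (snd (shrink t z))\<^sup>2 = (l\<^sup>2 * r / D) * r"
    and "snd (shrink t z) = (l\<^sup>2 * r / D) * snd z"
    and "0 < D"
proof -
  show D: "0 < D" unfolding D_def l_def r_def by (rule shrink_denom[OF assms(1)])
  have s: "shrink t z = ((r / D) * (l * fst z), (r / D) * (l\<^sup>2 * snd z))"
    unfolding shrink_def Let_def r_def l_def D_def by simp
  have "(fst (shrink t z))\<^sup>2 + (snd (shrink t z))\<^sup>2 = (r / D)\<^sup>2 * l\<^sup>2 * D"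
  proof -
    have "(c * (l * a))\<^sup>2 + (c * (l\<^sup>2 * b))\<^sup>2 = c\<^sup>2 * l\<^sup>2 * (a\<^sup>2 + l\<^sup>2 * b\<^sup>2)" for a b c :: real
      by (simp add: algebra_simps power2_eq_square)
    then show ?thesis unfolding s D_def fst_conv snd_conv .
  qed
  also have "\<dots> = (l\<^sup>2 * r / D) * r" using D by (simp add: power2_eq_square field_simps)
  finally show "(fst (shrink t z))\<^sup>2 + (snd (shrink t z))\<^sup>2 = (l\<^sup>2 * r / D) * r" .
  show "snd (shrink t z) = (l\<^sup>2 * r / D) * snd z" unfolding s by simp
qed

text \<open>The factor on the squared norm is at most 1 because \<open>l\<close> is. The bound
  serves for continuity at the origin, where the denominators in the formula vanish.\<close>

lemma norm_shrink_le:
  assumes "0 \<le> t"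
  shows "norm (shrink t z) \<le> norm z"
proof (cases "z = 0")
  case False
  define r where "r = (fst z)\<^sup>2 + (snd z)\<^sup>2"
  define l where "l = max 0 (1 - t * (\<bar>fst z\<bar> / r))"
  define D where "D = (fst z)\<^sup>2 + l\<^sup>2 * (snd z)\<^sup>2"
  note * = shrink_sq[OF False, of t, folded r_def, folded l_def, folded D_def] sq_sum_pos[OF False, folded r_def]
  have "0 \<le> t * (\<bar>fst z\<bar> / r)" using assms *(4) by simp
  then have l: "0 \<le> l" "l \<le> 1" unfolding l_def by auto
  have "l\<^sup>2 * (fst z)\<^sup>2 \<le> (fst z)\<^sup>2" using l by (simp add: mult_left_le_one_le power_le_one)
  then have "l\<^sup>2 * r \<le> D" unfolding r_def D_def by (simp add: distrib_left)
  then have "(l\<^sup>2 * r / D) * r \<le> 1 * r" using *(3,4) by (intro mult_right_mono) auto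
  then have "(norm (shrink t z))\<^sup>2 \<le> (norm z)\<^sup>2"
    unfolding norm_sq_prod *(1) by (simp add: r_def)
  then show ?thesis by simp
qed simp

text \<open>The circles and the sets \<open>HE_outer N\<close>, \<open>HE_inner N\<close> are
  described by homogeneous relations between height and squared norm; a common nonnegative factor is
  all that their invariance needs.\<close>

lemma shrink_scale:
  obtains c where "0 \<le> c" "snd (shrink t z) = c * snd z"
    "(fst (shrink t z))\<^sup>2 + (snd (shrink t z))\<^sup>2 = c * ((fst z)\<^sup>2 + (snd z)\<^sup>2)"
proof (cases "z = 0")
  case True
  then show ?thesis using that[of 0] by simp
next
  case False
  show ?thesis
    by (rule that[OF _ shrink_sq(2,1)[OF False, of t]])
       (use shrink_sq(3)[OF False, of t] in \<open>auto intro!: divide_nonneg_pos\<close>)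
qed

lemma shrink_HE:
  assumes "z \<in> hawaiian_earring"
  shows "shrink t z \<in> hawaiian_earring"
proof -
  obtain n where n: "1 \<le> n" "real n * ((fst z)\<^sup>2 + (snd z)\<^sup>2) = 2 * snd z"
    using assms by (blast elim: HE_E)
  obtain c where c: "snd (shrink t z) = c * snd z"
    "(fst (shrink t z))\<^sup>2 + (snd (shrink t z))\<^sup>2 = c * ((fst z)\<^sup>2 + (snd z)\<^sup>2)"
    by (rule shrink_scale)
  show ?thesis
  proof (rule HE_I[OF n(1)])
    have "c * (real n * ((fst z)\<^sup>2 + (snd z)\<^sup>2)) = c * (2 * snd z)" using n(2) by simp
    then show "real n * ((fst (shrink t z))\<^sup>2 + (snd (shrink t z))\<^sup>2) = 2 * snd (shrink t z)"
      unfolding c(2) unfolding c(1) by (simp only: mult.left_commute)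
  qed
qed

lemma shrink_outer:
  assumes "z \<in> HE_outer N"
  shows "shrink t z \<in> HE_outer N"
proof -
  have z: "z \<in> hawaiian_earring" "2 * snd z \<le> real N * ((fst z)\<^sup>2 + (snd z)\<^sup>2)"
    using assms unfolding HE_outer_def by auto
  obtain c where c: "0 \<le> c" "snd (shrink t z) = c * snd z"
    "(fst (shrink t z))\<^sup>2 + (snd (shrink t z))\<^sup>2 = c * ((fst z)\<^sup>2 + (snd z)\<^sup>2)"
    by (rule shrink_scale)
  have "c * (2 * snd z) \<le> c * (real N * ((fst z)\<^sup>2 + (snd z)\<^sup>2))"
    using z(2) c(1) by (rule mult_left_mono)
  then have "2 * snd (shrink t z) \<le> real N * ((fst (shrink t z))\<^sup>2 + (snd (shrink t z))\<^sup>2)"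
    unfolding c(3) unfolding c(2) by (simp only: mult.left_commute)
  then show ?thesis unfolding HE_outer_def using shrink_HE[OF z(1)] by blast
qed

lemma shrink_inner:
  assumes "z \<in> HE_inner N"
  shows "shrink t z \<in> HE_inner N"
proof -
  have z: "z \<in> hawaiian_earring" "real (Suc N) * ((fst z)\<^sup>2 + (snd z)\<^sup>2) \<le> 2 * snd z"
    using assms unfolding HE_inner_def by auto
  obtain c where c: "0 \<le> c" "snd (shrink t z) = c * snd z"
    "(fst (shrink t z))\<^sup>2 + (snd (shrink t z))\<^sup>2 = c * ((fst z)\<^sup>2 + (snd z)\<^sup>2)"
    by (rule shrink_scale)
  have "c * (real (Suc N) * ((fst z)\<^sup>2 + (snd z)\<^sup>2)) \<le> c * (2 * snd z)"
    using z(2) c(1) by (rule mult_left_mono)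
  then have "real (Suc N) * ((fst (shrink t z))\<^sup>2 + (snd (shrink t z))\<^sup>2) \<le> 2 * snd (shrink t z)"
    unfolding c(3) unfolding c(2) by (simp only: mult.left_commute)
  then show ?thesis unfolding HE_inner_def using shrink_HE[OF z(1)] by blast
qed

text \<open>Away from the origin of the plane the denominators do not vanish. At the origin the
  value is squeezed by \<open>norm_shrink_le\<close>, which asks for nonnegative times.\<close>

lemma continuous_on_shrink: "continuous_on ({0..} \<times> UNIV) (\<lambda>w. shrink (fst w) (snd w))"
proof -
  let ?f = "\<lambda>w. shrink (fst w) (snd w)"
  let ?O = "UNIV \<times> (- {0 :: real \<times> real})"
  have cont: "continuous_on ?O ?f"
  proof -
    have O: "snd w \<noteq> 0" if "w \<in> ?O" for w :: "real \<times> real \<times> real" using that by auto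
    show ?thesis
      unfolding shrink_def Let_def
      by (intro continuous_intros ballI)
         (erule O[THEN sq_sum_pos, THEN less_imp_neq, THEN not_sym]
           O[THEN shrink_denom, THEN less_imp_neq, THEN not_sym])+
  qed
  have "open ?O" by (intro open_Times) auto
  have "continuous (at w within {0..} \<times> UNIV) ?f" if "w \<in> {0..} \<times> UNIV" for w
  proof (cases "snd w = 0")
    case False
    then have "w \<in> ?O" by (cases w) auto
    then show ?thesis
      using continuous_on_eq_continuous_at[OF \<open>open ?O\<close>] cont continuous_at_imp_continuous_within by blast
  next
    case True
    have "(?f \<longlongrightarrow> 0) (at w within {0..} \<times> UNIV)"
    proof (rule Lim_null_comparison)
      show "\<forall>\<^sub>F x in at w within {0..} \<times> UNIV. norm (?f x) \<le> norm (snd x)"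
        unfolding eventually_at_filter
        by (intro always_eventually allI impI norm_shrink_le) auto
      have "(snd \<longlongrightarrow> snd w) (at w within {0..} \<times> UNIV)"
        by (intro tendsto_snd tendsto_ident_at)
      then show "((\<lambda>x. norm (snd x)) \<longlongrightarrow> 0) (at w within {0..} \<times> UNIV)"
        using True tendsto_norm by fastforce
    qed
    then show ?thesis unfolding continuous_within using True by simp
  qed
  then show ?thesis unfolding continuous_on_eq_continuous_within by blast
qed

text \<open>On the first \<open>N\<close> circles the height is at most \<open>N\<close> times half
  the squared norm \<open>r\<close>, so close to the origin the horizontal coordinate is at least
  \<open>r\<close> in absolute value and \<open>l\<close> vanishes at time 1. The end of the
  homotopy thus sends a neighbourhood of the base point in the outer circles to the base
  point.\<close>

lemma shrink_eq_zero:
  assumes "z \<in> HE_outer N" "norm z \<le> 1 / (1 + real N)"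
  shows "shrink 1 z = 0"
proof (cases "z = 0")
  case False
  obtain x y where z: "z = (x, y)" by (cases z)
  define r where "r = x\<^sup>2 + y\<^sup>2"
  have r: "0 < r" using sq_sum_pos[OF False] unfolding r_def z by simp
  have y: "2 * y \<le> real N * r" "0 \<le> y"
  proof -
    show "2 * y \<le> real N * r" using assms(1) unfolding HE_outer_def z r_def by simp
    obtain n where "real n * (x\<^sup>2 + y\<^sup>2) = 2 * y"
      using assms(1) unfolding HE_outer_def z by (auto elim!: HE_E)
    then have "2 * y = real n * r" unfolding r_def by simp
    also have "0 \<le> real n * r" using r by simp
    finally have "0 \<le> 2 * y" .
    then show "0 \<le> y" by simp
  qed
  have "(norm z)\<^sup>2 \<le> (1 / (1 + real N))\<^sup>2" using assms(2) by (intro power_mono) auto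
  then have "r \<le> 1 / (1 + real N)\<^sup>2" unfolding norm_sq_prod z r_def by (simp add: power_divide)
  then have "r * (1 + real N)\<^sup>2 \<le> 1" by (simp add: field_simps)
  moreover have "r * (4 + (real N)\<^sup>2) \<le> r * (4 * (1 + real N)\<^sup>2)"
    using r by (intro mult_left_mono) (auto simp: power2_eq_square algebra_simps)
  \<comment> \<open>Multiplied by \<open>r\<close>, and with \<open>2 * y\<close> at most
    \<open>N * r\<close>, this bounds \<open>4 * r\<^sup>2 + 4 * y\<^sup>2\<close> by
    \<open>4 * r\<close>, which amounts to \<open>r\<^sup>2 \<le> x\<^sup>2\<close>.\<close>
  ultimately have rN: "r * (4 + (real N)\<^sup>2) \<le> 4" by linarith
  have "(2 * y)\<^sup>2 \<le> (real N * r)\<^sup>2" using y by (intro power_mono) auto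
  then have "4 * r\<^sup>2 + 4 * y\<^sup>2 \<le> r * (r * (4 + (real N)\<^sup>2))"
    by (simp add: power2_eq_square algebra_simps)
  also have "\<dots> \<le> r * 4" using r rN by (intro mult_left_mono) auto
  finally have "r\<^sup>2 \<le> x\<^sup>2" unfolding r_def by simp
  then have "r \<le> \<bar>x\<bar>" using r abs_le_square_iff[of r x] by simp
  then have "1 \<le> \<bar>x\<bar> / r" using r by simp
  then show ?thesis unfolding shrink_def z Let_def by (simp add: r_def zero_prod_def)
qed simp

section \<open>Splitting loops\<close>

abbreviation "HE \<equiv> hawaiian_earring"

section \<open>Loops, their classes and the operations on them\<close>

lemma HE_loopsD:
  assumes "p \<in> HE_loops"
  shows "path p" "path_image p \<subseteq> HE" "pathstart p = 0" "pathfinish p = 0"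
  using assms unfolding HE_loops_def by (auto simp: zero_prod_def)

lemma HE_loopsI:
  assumes "path p" "path_image p \<subseteq> HE" "pathstart p = 0" "pathfinish p = 0"
  shows "p \<in> HE_loops"
  using assms unfolding HE_loops_def by (auto simp: zero_prod_def)

lemma const_in_HE_loops: "(\<lambda>t. 0) \<in> HE_loops"
  by (rule HE_loopsI) (auto simp: path_def path_image_def pathstart_def pathfinish_def zero_in_HE)

lemma HE_class_cong:
  assumes "homotopic_paths HE p q"
  shows "HE_class p = HE_class q"
  using homotopic_paths_trans[OF assms] homotopic_paths_trans[OF homotopic_paths_sym[OF assms]]
  unfolding HE_class_def by blast

text \<open>Products and projections in \<open>HE_group\<close> are computed on representatives
  picked by \<open>SOME\<close>; this is what makes the choice immaterial.\<close>

lemma HE_some_homotopic: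
  assumes "p \<in> HE_loops"
  shows "homotopic_paths HE p (SOME q. q \<in> HE_class p)"
proof -
  have "p \<in> HE_class p"
    unfolding HE_class_def using HE_loopsD[OF assms] by (simp add: homotopic_paths_refl)
  then have "(SOME q. q \<in> HE_class p) \<in> HE_class p"
    using someI[of "\<lambda>q. q \<in> HE_class p" p] by blast
  then show ?thesis unfolding HE_class_def by simp
qed

lemma HE_loops_homotopic:
  assumes "p \<in> HE_loops" "homotopic_paths HE p q"
  shows "q \<in> HE_loops"
proof (rule HE_loopsI)
  show "path q" using homotopic_paths_imp_path[OF assms(2)] by blast
  show "path_image q \<subseteq> HE" using homotopic_paths_imp_subset[OF assms(2)] by blast
  show "pathstart q = 0" "pathfinish q = 0"
    using homotopic_paths_imp_pathstart[OF assms(2)] homotopic_paths_imp_pathfinish[OF assms(2)]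
      HE_loopsD[OF assms(1)] by auto
qed

lemma HE_loops_join:
  assumes "p \<in> HE_loops" "q \<in> HE_loops"
  shows "p +++ q \<in> HE_loops"
  using HE_loopsD[OF assms(1)] HE_loopsD[OF assms(2)]
  by (intro HE_loopsI) (auto simp: path_join_imp subset_path_image_join)

lemma HE_loops_compose:
  assumes "p \<in> HE_loops" "continuous_on HE f" "f ` HE \<subseteq> HE" "f 0 = 0"
  shows "f \<circ> p \<in> HE_loops"
proof (rule HE_loopsI)
  note p = HE_loopsD[OF assms(1)]
  show "path (f \<circ> p)" 
    using p(1) continuous_on_subset[OF assms(2) p(2)] by (rule path_continuous_image)
  show "path_image (f \<circ> p) \<subseteq> HE" using p assms(3) by (auto simp: path_image_compose)
  show "pathstart (f \<circ> p) = 0" "pathfinish (f \<circ> p) = 0"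
    using p assms(4) by (auto simp: pathstart_compose pathfinish_compose)
qed

lemma HE_mult_class:
  assumes "p \<in> HE_loops" "q \<in> HE_loops"
  shows "HE_class p \<otimes>\<^bsub>HE_group\<^esub> HE_class q = HE_class (p +++ q)"
proof -
  let ?p = "SOME r. r \<in> HE_class p" and ?q = "SOME r. r \<in> HE_class q"
  have h: "homotopic_paths HE p ?p" "homotopic_paths HE q ?q"
    using assms by (auto intro: HE_some_homotopic)
  have "pathfinish p = pathstart q" using HE_loopsD[OF assms(1)] HE_loopsD[OF assms(2)] by simp
  then have "HE_class (?p +++ ?q) = HE_class (p +++ q)"
    using HE_class_cong[OF homotopic_paths_join[OF h]] by simp
  then show ?thesis unfolding HE_group_def by simp
qed

lemma collapse_onto_HE:
  "collapse_onto S ` HE \<subseteq> HE" "collapse_onto S 0 = 0"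
  unfolding collapse_onto_def using zero_in_HE by auto

lemma HE_proj_class:
  assumes "p \<in> HE_loops"
  shows "HE_proj N (HE_class p) = HE_class (collapse_onto (HE_outer N) \<circ> p)"
proof -
  let ?q = "SOME q. q \<in> HE_class p"
  have "HE_retract N = collapse_onto (HE_outer N)" by (rule ext) (rule HE_retract_eq)
  moreover have "homotopic_paths HE (collapse_onto (HE_outer N) \<circ> ?q) (collapse_onto (HE_outer N) \<circ> p)"
    using HE_some_homotopic[OF assms] continuous_on_collapse_outer collapse_onto_HE(1)
    by (intro homotopic_paths_continuous_image[where S = HE]) (auto simp: homotopic_paths_sym)
  ultimately show ?thesis unfolding HE_proj_def by (simp add: HE_class_cong)
qed

text \<open>\<open>shrink\<close> is the identity at time 0 and fixes the origin, so letting time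
  run from 0 to 1 is a homotopy relative to the end points.\<close>

lemma homotopic_shrink:
  assumes "p \<in> HE_loops"
  shows "homotopic_paths HE p (shrink 1 \<circ> p)"
  unfolding homotopic_paths
proof (intro exI conjI ballI)
  note p = HE_loopsD[OF assms]
  let ?h = "\<lambda>y. shrink (fst y) (p (snd y))"
  have "continuous_on ({0..1} \<times> {0..1}) (\<lambda>y. p (snd y))"
    using p(1) unfolding path_def
    by (intro continuous_on_compose2[OF _ continuous_on_snd[OF continuous_on_id]]) auto
  then have "continuous_on ({0..1} \<times> {0..1}) (\<lambda>y. (fst y, p (snd y)))"
    by (intro continuous_intros)
  then show "continuous_on ({0..1} \<times> {0..1}) ?h"
    by (rule continuous_on_compose2[OF continuous_on_shrink, of _ "\<lambda>y. (fst y, p (snd y))", simplified]) auto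
  show "?h \<in> {0..1} \<times> {0..1} \<rightarrow> HE"
    using p(2) unfolding path_image_def by (intro Pi_I shrink_HE) auto
qed (use HE_loopsD[OF assms] in \<open>auto simp: shrink_0 pathstart_def pathfinish_def\<close>)

section \<open>Values of a homomorphism on outer and inner parts of loops\<close>

locale HE_hom = comm_group A for A (structure) +
  fixes \<phi>
  assumes hom: "\<phi> \<in> hom HE_group A"
begin

definition val :: "(real \<Rightarrow> real \<times> real) \<Rightarrow> 'a" where
  "val p = \<phi> (HE_class p)"

lemma val_closed [simp]: "p \<in> HE_loops \<Longrightarrow> val p \<in> carrier A"
  using hom unfolding val_def hom_def HE_group_def by auto

lemma val_cong: "homotopic_paths HE p q \<Longrightarrow> val p = val q"
  unfolding val_def using HE_class_cong by metis

lemma val_eq: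
  assumes "p \<in> HE_loops" "\<And>t. t \<in> {0..1} \<Longrightarrow> p t = q t"
  shows "val p = val q"
  using HE_loopsD[OF assms(1)] assms(2) by (intro val_cong homotopic_paths_eq) auto

lemma val_join: "p \<in> HE_loops \<Longrightarrow> q \<in> HE_loops \<Longrightarrow> val (p +++ q) = val p \<otimes> val q"
proof -
  assume pq: "p \<in> HE_loops" "q \<in> HE_loops"
  then have "HE_class p \<in> carrier HE_group" "HE_class q \<in> carrier HE_group"
    unfolding HE_group_def by auto
  then show ?thesis using hom_mult[OF hom] HE_mult_class[OF pq] unfolding val_def by metis
qed

text \<open>The constant loop equals its concatenation with itself, and one is the only idempotent
  of a group; multiplicativity of \<open>\<phi>\<close> is enough.\<close>

lemma val_const: "val (\<lambda>t. 0) = \<one>"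
proof -
  have "(\<lambda>t. 0 :: real \<times> real) +++ (\<lambda>t. 0) = (\<lambda>t. 0)" by (auto simp: joinpaths_def)
  then have "val (\<lambda>t. 0) \<otimes> val (\<lambda>t. 0) = val (\<lambda>t. 0)"
    using val_join[OF const_in_HE_loops const_in_HE_loops] by simp
  then show ?thesis using const_in_HE_loops by simp
qed

text \<open>In the earring group the outer and inner parts of a loop may alternate and need not
  commute; the product formula is a statement about values in the abelian group
  \<open>A\<close>.\<close>

definition splits :: "nat \<Rightarrow> (real \<Rightarrow> real \<times> real) \<Rightarrow> bool" where
  "splits N p \<longleftrightarrow> p \<in> HE_loops \<and>
     val p = val (collapse_onto (HE_outer N) \<circ> p) \<otimes> val (collapse_onto (HE_inner N) \<circ> p)"

lemma collapse_outer_loop: "p \<in> HE_loops \<Longrightarrow> collapse_onto (HE_outer N) \<circ> p \<in> HE_loops"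
  by (intro HE_loops_compose continuous_on_collapse_outer collapse_onto_HE)

lemma collapse_inner_loop: "p \<in> HE_loops \<Longrightarrow> collapse_onto (HE_inner N) \<circ> p \<in> HE_loops"
  by (intro HE_loops_compose continuous_on_collapse_inner collapse_onto_HE)

lemma splits_homotopic:
  assumes "splits N p" "homotopic_paths HE p q"
  shows "splits N q"
proof -
  have "val (collapse_onto (HE_outer N) \<circ> p) = val (collapse_onto (HE_outer N) \<circ> q)"
    using assms(2) continuous_on_collapse_outer collapse_onto_HE(1)
    by (intro val_cong homotopic_paths_continuous_image[where S = HE]) auto
  moreover have "val (collapse_onto (HE_inner N) \<circ> p) = val (collapse_onto (HE_inner N) \<circ> q)"
    using assms(2) continuous_on_collapse_inner collapse_onto_HE(1)
    by (intro val_cong homotopic_paths_continuous_image[where S = HE]) auto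
  ultimately show ?thesis
    using assms val_cong[OF assms(2)] HE_loops_homotopic unfolding splits_def by metis
qed

text \<open>Here commutativity of \<open>A\<close> collects the outer and the inner factors of both
  loops.\<close>

lemma splits_join:
  assumes "splits N p" "splits N q"
  shows "splits N (p +++ q)"
proof -
  have pq: "p \<in> HE_loops" "q \<in> HE_loops" using assms unfolding splits_def by auto
  show ?thesis
    using assms pq unfolding splits_def
    by (simp add: HE_loops_join val_join path_compose_join collapse_outer_loop collapse_inner_loop m_ac)
qed

lemma splits_outer:
  assumes "p \<in> HE_loops" "path_image p \<subseteq> HE_outer N"
  shows "splits N p"
proof -
  have o: "p t \<in> HE_outer N" if "t \<in> {0..1}" for t using assms(2) that unfolding path_image_def by auto
  have "val p = val (collapse_onto (HE_outer N) \<circ> p)"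
    using assms(1) by (rule val_eq) (use o in \<open>simp add: collapse_onto_def\<close>)
  moreover have "val (\<lambda>t. 0) = val (collapse_onto (HE_inner N) \<circ> p)"
    using const_in_HE_loops
    by (rule val_eq) (use o HE_outer_Int_inner[of N] in \<open>auto simp: collapse_onto_def\<close>)
  ultimately show ?thesis unfolding splits_def using assms(1) val_const by (metis l_one r_one val_closed)
qed

lemma splits_inner:
  assumes "p \<in> HE_loops" "path_image p \<subseteq> HE_inner N"
  shows "splits N p"
proof -
  have o: "p t \<in> HE_inner N" if "t \<in> {0..1}" for t using assms(2) that unfolding path_image_def by auto
  have "val p = val (collapse_onto (HE_inner N) \<circ> p)"
    using assms(1) by (rule val_eq) (use o in \<open>simp add: collapse_onto_def\<close>)
  moreover have "val (\<lambda>t. 0) = val (collapse_onto (HE_outer N) \<circ> p)"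
    using const_in_HE_loops
    by (rule val_eq) (use o HE_outer_Int_inner[of N] in \<open>auto simp: collapse_onto_def\<close>)
  ultimately show ?thesis unfolding splits_def using assms(1) val_const by (metis l_one r_one val_closed)
qed

end

text \<open>A loop may change between outer and inner circles infinitely often, but only through the
  origin. On a piece of a fine subdivision that meets the origin, the outer points of
  \<open>p\<close> are so close to it that \<open>shrink 1\<close> sends them there; a piece that
  avoids the origin is connected and stays on one side.\<close>

lemma shrink_pieces:
  assumes "p \<in> HE_loops"
  obtains m :: nat where "0 < m"
    "\<And>i. i < m \<Longrightarrow> (shrink 1 \<circ> p) ` {real i / real m .. real (Suc i) / real m} \<subseteq> HE_outer N \<or>
                  (shrink 1 \<circ> p) ` {real i / real m .. real (Suc i) / real m} \<subseteq> HE_inner N"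
proof -
  note p = HE_loopsD[OF assms]
  have "uniformly_continuous_on {0..1} p"
    using p(1) unfolding path_def by (intro compact_uniformly_continuous) auto
  moreover have "0 < 1 / (1 + real N)" by simp
  ultimately obtain d where d: "0 < d"
    "\<And>s t. s \<in> {0..1} \<Longrightarrow> t \<in> {0..1} \<Longrightarrow> dist t s < d \<Longrightarrow> dist (p t) (p s) < 1 / (1 + real N)"
    unfolding uniformly_continuous_on_def by blast
  obtain m :: nat where m: "0 < m" "1 / real m < d"
    using d(1) by (metis ex_inverse_of_nat_less inverse_eq_divide)
  show ?thesis
  proof (rule that[OF m(1)])
    fix i assume "i < m"
    define I where "I = {real i / real m .. real (Suc i) / real m}"
    have I01: "I \<subseteq> {0..1}"
      using \<open>i < m\<close> m(1) unfolding I_def by (auto simp: field_simps)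
    have pI: "p t \<in> HE" if "t \<in> I" for t using p(2) I01 that unfolding path_image_def by auto
    have diam: "dist t s < d" if "s \<in> I" "t \<in> I" for s t
    proof -
      have "real (Suc i) / real m = real i / real m + 1 / real m" by (simp add: add_divide_distrib)
      then have "dist t s \<le> 1 / real m" using that unfolding I_def dist_real_def by auto
      then show ?thesis using m(2) by simp
    qed
    show "(shrink 1 \<circ> p) ` I \<subseteq> HE_outer N \<or> (shrink 1 \<circ> p) ` I \<subseteq> HE_inner N"
    proof (cases "\<exists>s\<in>I. p s = 0")
      case True
      then obtain s where s: "s \<in> I" "p s = 0" by blast
      have "shrink 1 (p t) \<in> HE_inner N" if "t \<in> I" for t
      proof (cases "p t \<in> HE_inner N")
        case False
        then have "p t \<in> HE_outer N" using HE_outer_Un_inner pI[OF that] by blast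
        moreover have "dist (p t) (p s) < 1 / (1 + real N)"
          using d(2) s(1) that I01 diam by blast
        ultimately have "shrink 1 (p t) = 0" using s(2) shrink_eq_zero by simp
        then show ?thesis using HE_outer_Int_inner by blast
      qed (rule shrink_inner)
      then show ?thesis by auto
    next
      case False
      have "continuous_on I p" using p(1) I01 unfolding path_def by (rule continuous_on_subset)
      then have "connected (p ` I)" unfolding I_def by (intro connected_continuous_image) auto
      moreover have "p ` I \<subseteq> HE_outer N \<union> HE_inner N" using pI HE_outer_Un_inner by auto
      moreover have "HE_outer N \<inter> HE_inner N \<inter> p ` I = {}"
        using False HE_outer_Int_inner by auto
      ultimately have "HE_outer N \<inter> p ` I = {} \<or> HE_inner N \<inter> p ` I = {}"
        using closed_HE_outer[of N] closed_HE_inner[of N] unfolding connected_closed by blast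
      then have "p ` I \<subseteq> HE_inner N \<or> p ` I \<subseteq> HE_outer N"
        using \<open>p ` I \<subseteq> HE_outer N \<union> HE_inner N\<close> by blast
      then show ?thesis
        using shrink_inner[of _ N 1] shrink_outer[of _ N 1] unfolding image_comp[symmetric] by blast
    qed
  qed
qed

context HE_hom
begin

text \<open>Cut \<open>q\<close> at the subdivision points where it vanishes. Between two
  consecutive ones, neighbouring pieces meet outside the origin and therefore lie on the same side,
  so each resulting subloop is entirely outer or entirely inner.\<close>

lemma splits_pieces:
  assumes q: "q \<in> HE_loops" and m: "0 < (m::nat)"
    and pieces: "\<And>i. i < m \<Longrightarrow> q ` {real i / real m .. real (Suc i) / real m} \<subseteq> HE_outer N \<or>
                  q ` {real i / real m .. real (Suc i) / real m} \<subseteq> HE_inner N"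
  shows "splits N q"
proof -
  note qD = HE_loopsD[OF q]
  let ?u = "\<lambda>i. real i / real m"
  have u01: "?u i \<in> {0..1}" if "i \<le> m" for i using that m by (simp add: field_simps)
  have loop: "subpath (?u j) (?u i) q \<in> HE_loops"
    if "i \<le> m" "j \<le> m" "q (?u i) = 0" "q (?u j) = 0" for i j
  proof (rule HE_loopsI)
    note u = u01[OF that(1)] u01[OF that(2)]
    show "path (subpath (?u j) (?u i) q)" using u qD(1) by (intro path_subpath)
    show "path_image (subpath (?u j) (?u i) q) \<subseteq> HE"
      using path_image_subpath_subset[OF u(2,1), of q] qD(2) by blast
  qed (use that in auto)
  have "i \<le> m \<Longrightarrow> q (?u i) = 0 \<Longrightarrow> splits N (subpath 0 (?u i) q)" for i
  proof (induction i rule: less_induct)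
    case (less i)
    show ?case
    proof (cases "i = 0")
      case True
      have "splits N (\<lambda>t. 0)"
        using const_in_HE_loops HE_outer_Int_inner[of N] by (intro splits_outer) (auto simp: path_image_def)
      moreover have "subpath 0 (?u i) q = (\<lambda>t. 0)"
        using True less.prems unfolding subpath_def by auto
      ultimately show ?thesis by simp
    next
      case False
      \<comment> \<open>The last earlier subdivision point at the origin; up to homotopy, the loop
        up to \<open>i\<close> is the loop up to \<open>j\<close> followed by a one-sided
        subloop.\<close>
      define j where "j = Max {j. j < i \<and> q (?u j) = 0}"
      have fin: "finite {j. j < i \<and> q (?u j) = 0}" by simp
      moreover have "0 \<in> {j. j < i \<and> q (?u j) = 0}" using False qD(3) by (simp add: pathstart_def)
      ultimately have j: "j < i" "q (?u j) = 0" using Max_in unfolding j_def by blast+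
      have between: "q (?u k) \<noteq> 0" if "j < k" "k < i" for k
        using Max_ge[OF fin, of k] that unfolding j_def[symmetric] by auto
      have same: "q ` {?u j .. ?u (Suc j + n)} \<subseteq> B"
        if B: "B = HE_outer N \<or> B = HE_inner N" and base: "q ` {?u j .. ?u (Suc j)} \<subseteq> B"
          and "Suc j + n \<le> i" for B n
        using that(3)
      proof (induction n)
        case (Suc n)
        let ?k = "Suc j + n"
        have k: "?k < m" "j < ?k" "?k < i" using Suc.prems less.prems by auto
        have IH: "q ` {?u j .. ?u ?k} \<subseteq> B" using Suc by simp
        have le: "?u j \<le> ?u ?k" "?u ?k \<le> ?u (Suc ?k)" using m by (auto simp: divide_right_mono)
        have ne: "q (?u ?k) \<noteq> 0" using between k by blast
        have "q ` {?u ?k .. ?u (Suc ?k)} \<subseteq> B"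
        proof -
          have "q (?u ?k) \<in> B" "q (?u ?k) \<in> q ` {?u ?k .. ?u (Suc ?k)}" using IH le by auto
          then show ?thesis using pieces[OF k(1)] B ne HE_outer_Int_inner[of N] by blast
        qed
        moreover have "{?u j .. ?u (Suc ?k)} \<subseteq> {?u j .. ?u ?k} \<union> {?u ?k .. ?u (Suc ?k)}" by auto
        ultimately have "q ` {?u j .. ?u (Suc ?k)} \<subseteq> B" using IH by blast
        then show ?case by simp
      qed (use base in simp)
      have "i = Suc j + (i - Suc j)" using j(1) by simp
      then have "q ` {?u j .. ?u i} \<subseteq> HE_outer N \<or> q ` {?u j .. ?u i} \<subseteq> HE_inner N"
        using pieces[of j] same[of "HE_outer N" "i - Suc j"] same[of "HE_inner N" "i - Suc j"] j(1) less.prems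
        by auto
      moreover have "path_image (subpath (?u j) (?u i) q) = q ` {?u j .. ?u i}"
        using j(1) m by (simp add: path_image_subpath divide_right_mono)
      ultimately have "splits N (subpath (?u j) (?u i) q)"
        using loop[of i j] less.prems j splits_outer splits_inner by auto
      moreover have "splits N (subpath 0 (?u j) q)"
        using less.IH[OF j(1)] less.prems j by auto
      ultimately have "splits N (subpath 0 (?u j) q +++ subpath (?u j) (?u i) q)"
        by (intro splits_join)
      moreover have "homotopic_paths HE (subpath 0 (?u j) q +++ subpath (?u j) (?u i) q) (subpath 0 (?u i) q)"
        using u01[of i] u01[of j] less.prems j qD by (intro homotopic_join_subpaths) auto
      ultimately show ?thesis by (rule splits_homotopic)
    qed
  qed
  from this[of m] show ?thesis using m qD(4) by (simp add: pathfinish_def)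
qed

lemma splits_loop:
  assumes "p \<in> HE_loops"
  shows "splits N p"
proof -
  have sp: "homotopic_paths HE p (shrink 1 \<circ> p)" by (rule homotopic_shrink[OF assms])
  obtain m :: nat where m: "0 < m"
    "\<And>i. i < m \<Longrightarrow> (shrink 1 \<circ> p) ` {real i / real m .. real (Suc i) / real m} \<subseteq> HE_outer N \<or>
                  (shrink 1 \<circ> p) ` {real i / real m .. real (Suc i) / real m} \<subseteq> HE_inner N"
    by (rule shrink_pieces[OF assms, of N]) blast
  have "splits N (shrink 1 \<circ> p)"
    by (rule splits_pieces[OF HE_loops_homotopic[OF assms sp] m])
  then show ?thesis using sp by (rule splits_homotopic[OF _ homotopic_paths_sym])
qed

end

section \<open>Infinite concatenations\<close>

primrec path_pow :: "(real \<Rightarrow> real \<times> real) \<Rightarrow> nat \<Rightarrow> real \<Rightarrow> real \<times> real" where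
  "path_pow p 0 = (\<lambda>t. 0)"
| "path_pow p (Suc k) = p +++ path_pow p k"

definition path_step :: "(nat \<Rightarrow> real \<Rightarrow> real \<times> real) \<Rightarrow> (nat \<Rightarrow> nat) \<Rightarrow> (nat \<Rightarrow> bool) \<Rightarrow> nat \<Rightarrow>
    (real \<Rightarrow> real \<times> real) \<Rightarrow> real \<Rightarrow> real \<times> real" where
  "path_step g k e n x = (if e n then g n else (\<lambda>t. 0)) +++ path_pow x (k n)"

text \<open>The parameter \<open>s\<close> depends on \<open>t\<close> only, not on the paths, so
  two concatenations, or a whole sequence of them, can be compared pointwise.\<close>

lemma joinpaths_cases:
  assumes "t \<in> {0..1::real}"
  obtains s where "s \<in> {0..1}" "\<And>p q :: real \<Rightarrow> real \<times> real. (p +++ q) t = p s"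
  | s where "s \<in> {0..1}" "\<And>p q :: real \<Rightarrow> real \<times> real. (p +++ q) t = q s"
proof (cases "t \<le> 1/2")
  case True
  then show ?thesis using that(1)[of "2 * t"] assms by (simp add: joinpaths_def)
next
  case False
  then show ?thesis using that(2)[of "2 * t - 1"] assms by (simp add: joinpaths_def)
qed

lemma path_pow_loop: "p \<in> HE_loops \<Longrightarrow> path_pow p k \<in> HE_loops"
  by (induction k) (auto simp: const_in_HE_loops HE_loops_join)

lemma path_pow_image:
  assumes "\<And>t. t \<in> {0..1} \<Longrightarrow> p t \<in> S" "0 \<in> S" "t \<in> {0..1}"
  shows "path_pow p k t \<in> S"
  using assms(3)
proof (induction k arbitrary: t)
  case (Suc k)
  show ?case using Suc by (cases rule: joinpaths_cases[OF Suc.prems]) (auto simp: assms(1))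
qed (simp add: assms(2))

lemma path_pow_dist:
  assumes "\<And>t. t \<in> {0..1} \<Longrightarrow> dist (p t) (q t) \<le> c" "0 \<le> c" "t \<in> {0..1}"
  shows "dist (path_pow p k t) (path_pow q k t) \<le> c"
  using assms(3)
proof (induction k arbitrary: t)
  case (Suc k)
  show ?case using Suc by (cases rule: joinpaths_cases[OF Suc.prems]) (auto simp: assms(1))
qed (simp add: assms(2))

lemma path_pow_tendsto:
  assumes "\<And>t. t \<in> {0..1} \<Longrightarrow> (\<lambda>m. Y m t) \<longlonglongrightarrow> x t" "t \<in> {0..1}"
  shows "(\<lambda>m. path_pow (Y m) k t) \<longlonglongrightarrow> path_pow x k t"
  using assms(2)
proof (induction k arbitrary: t)
  case (Suc k)
  show ?case using Suc by (cases rule: joinpaths_cases[OF Suc.prems]) (auto simp: assms(1))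
qed simp

lemma path_step_dist:
  assumes "\<And>t. t \<in> {0..1} \<Longrightarrow> dist (p t) (q t) \<le> c" "0 \<le> c" "t \<in> {0..1}"
  shows "dist (path_step g k e n p t) (path_step g k e n q t) \<le> c"
  using path_pow_dist[of p q c] assms(1,2) unfolding path_step_def
  by (cases rule: joinpaths_cases[OF assms(3)]) auto

lemma path_step_tendsto:
  assumes "\<And>t. t \<in> {0..1} \<Longrightarrow> (\<lambda>m. Y m t) \<longlonglongrightarrow> x t" "t \<in> {0..1}"
  shows "(\<lambda>m. path_step g k e n (Y m) t) \<longlonglongrightarrow> path_step g k e n x t"
  using path_pow_tendsto[of Y x] assms(1) unfolding path_step_def
  by (cases rule: joinpaths_cases[OF assms(2)]) auto

lemma HE_inner_antimono: "HE_inner (Suc n) \<subseteq> HE_inner n"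
proof
  fix z assume z: "z \<in> HE_inner (Suc n)"
  have "real (Suc n) * ((fst z)\<^sup>2 + (snd z)\<^sup>2) \<le> real (Suc (Suc n)) * ((fst z)\<^sup>2 + (snd z)\<^sup>2)"
    by (intro mult_right_mono) auto
  then show "z \<in> HE_inner n" using z unfolding HE_inner_def by auto
qed

lemma zero_in_HE_inner: "0 \<in> HE_inner n"
  using HE_outer_Int_inner by blast

text \<open>The loops obtained after finitely many steps converge uniformly, since later steps only
  change points inside ever smaller circles. The equation is asserted on the unit interval, where
  the limits are known to exist.\<close>

lemma infinite_concatenation:
  assumes g: "\<And>n. g n \<in> HE_loops" and gi: "\<And>n t. t \<in> {0..1} \<Longrightarrow> g n t \<in> HE_inner n"
  obtains x where "\<And>n. x n \<in> HE_loops"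
    "\<And>n t. t \<in> {0..1} \<Longrightarrow> x n t = path_step g k e n (x (Suc n)) t"
proof -
  define F where "F = rec_nat (\<lambda>n t. 0 :: real \<times> real) (\<lambda>m Fm n. path_step g k e n (Fm (Suc n)))"
  have F0: "F 0 n = (\<lambda>t. 0)" and FS: "F (Suc m) n = path_step g k e n (F m (Suc n))" for m n
    unfolding F_def by auto
  have loop: "F m n \<in> HE_loops" for m n
    by (induction m arbitrary: n)
       (auto simp: F0 FS path_step_def const_in_HE_loops g intro!: HE_loops_join path_pow_loop)
  have inner: "F m n t \<in> HE_inner n" if "t \<in> {0..1}" for m n t
    using that
  proof (induction m arbitrary: n t)
    case (Suc m)
    have "F m (Suc n) s \<in> HE_inner n" if "s \<in> {0..1}" for s
      using Suc.IH[OF that] HE_inner_antimono by blast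
    then have "path_pow (F m (Suc n)) (k n) s \<in> HE_inner n" if "s \<in> {0..1}" for s
      using path_pow_image[of "F m (Suc n)"] zero_in_HE_inner that by blast
    then show ?case
      unfolding FS path_step_def using gi zero_in_HE_inner
      by (cases rule: joinpaths_cases[OF Suc.prems]) auto
  qed (simp add: F0 zero_in_HE_inner)
  \<comment> \<open>Both loops share the first \<open>m\<close> steps, which do not increase the
    uniform distance; the comparison ends at stage \<open>n + m\<close> with the constant loop
    against a loop in \<open>HE_inner (n + m)\<close>.\<close>
  have near: "dist (F m n t) (F (m + j) n t) \<le> 2 / real (Suc (n + m))" if "t \<in> {0..1}" for m n j t
    using that
  proof (induction m arbitrary: n t)
    case 0
    then show ?case using norm_HE_inner[OF inner] by (simp add: F0)
  next
    case (Suc m)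
    have "dist (path_step g k e n (F m (Suc n)) t) (path_step g k e n (F (m + j) (Suc n)) t)
        \<le> 2 / real (Suc (Suc n + m))"
      using Suc.IH[of _ "Suc n"] Suc.prems by (intro path_step_dist) simp_all
    then show ?case by (simp add: FS)
  qed
  define x where "x n t = lim (\<lambda>m. F m n t)" for n t
  have small: "\<exists>M. \<forall>m\<ge>M. 2 / real (Suc (n + m)) < \<epsilon>" if eps: "0 < \<epsilon>" for n and \<epsilon> :: real
  proof -
    obtain M where M: "inverse (real (Suc M)) < \<epsilon> / 2" using reals_Archimedean[of "\<epsilon> / 2"] half_gt_zero[OF eps]
      by blast
    have "2 / real (Suc (n + m)) < \<epsilon>" if "M \<le> m" for m
    proof -
      have "2 / real (Suc (n + m)) \<le> 2 / real (Suc M)" using that by (intro divide_left_mono) auto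
      then show ?thesis using M by (simp add: inverse_eq_divide)
    qed
    then show ?thesis by blast
  qed
  have lim: "(\<lambda>m. F m n t) \<longlonglongrightarrow> x n t" if t: "t \<in> {0..1}" for n t
  proof -
    have "Cauchy (\<lambda>m. F m n t)"
    proof (rule metric_CauchyI)
      fix \<epsilon> :: real assume "0 < \<epsilon>"
      then obtain M where M: "\<And>m. M \<le> m \<Longrightarrow> 2 / real (Suc (n + m)) < \<epsilon> / 2"
        using small[of "\<epsilon> / 2"] by auto
      have "dist (F i n t) (F j n t) < \<epsilon>" if "M \<le> i" "M \<le> j" for i j
      proof -
        have "dist (F M n t) (F i n t) < \<epsilon> / 2" "dist (F M n t) (F j n t) < \<epsilon> / 2"
          using near[OF t, of M n "i - M"] near[OF t, of M n "j - M"] M[of M] that by auto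
        then show ?thesis using dist_triangle3[of "F i n t" "F j n t" "F M n t"] by linarith
      qed
      then show "\<exists>M. \<forall>m\<ge>M. \<forall>n'\<ge>M. dist (F m n t) (F n' n t) < \<epsilon>" by blast
    qed
    then show ?thesis unfolding x_def by (simp add: Cauchy_convergent_iff convergent_LIMSEQ_iff)
  qed
  have close: "dist (F m n t) (x n t) \<le> 2 / real (Suc (n + m))" if t: "t \<in> {0..1}" for m n t
  proof (rule LIMSEQ_le_const2)
    show "(\<lambda>j. dist (F m n t) (F j n t)) \<longlonglongrightarrow> dist (F m n t) (x n t)"
      by (intro tendsto_intros lim t)
    show "\<exists>N. \<forall>j\<ge>N. dist (F m n t) (F j n t) \<le> 2 / real (Suc (n + m))"
      using near[OF t, of m n] by (metis le_iff_add)
  qed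
  have unif: "uniform_limit {0..1} (\<lambda>m. F m n) (x n) sequentially" for n
  proof (rule uniform_limitI)
    fix \<epsilon> :: real assume "0 < \<epsilon>"
    then obtain M where "\<And>m. M \<le> m \<Longrightarrow> 2 / real (Suc (n + m)) < \<epsilon>" using small by blast
    then show "\<forall>\<^sub>F m in sequentially. \<forall>t\<in>{0..1}. dist (F m n t) (x n t) < \<epsilon>"
      unfolding eventually_sequentially using close by (meson le_less_trans)
  qed
  have xloop: "x n \<in> HE_loops" for n
  proof (rule HE_loopsI)
    have "\<forall>\<^sub>F m in sequentially. continuous_on {0..1} (F m n)"
      using HE_loopsD(1)[OF loop] unfolding path_def by simp
    then show "path (x n)"
      unfolding path_def using unif by (rule uniform_limit_theorem) simp
    have FHE: "F m n t \<in> HE" if "t \<in> {0..1}" for m t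
      using HE_loopsD(2)[OF loop] that unfolding path_image_def by blast
    have "x n t \<in> HE" if "t \<in> {0..1}" for t
      by (rule closed_sequentially[OF closed_HE FHE[OF that] lim[OF that]])
    then show "path_image (x n) \<subseteq> HE" unfolding path_image_def by auto
    have "F m n 0 = 0" "F m n 1 = 0" for m
      using HE_loopsD(3,4)[OF loop] unfolding pathstart_def pathfinish_def by auto
    then show "pathstart (x n) = 0" "pathfinish (x n) = 0"
      using lim[of 0 n] lim[of 1 n] unfolding pathstart_def pathfinish_def by (auto dest: LIMSEQ_unique)
  qed
  have "x n t = path_step g k e n (x (Suc n)) t" if t: "t \<in> {0..1}" for n t
  proof (rule LIMSEQ_unique)
    show "(\<lambda>m. F (Suc m) n t) \<longlonglongrightarrow> x n t" using lim[OF t] by (rule LIMSEQ_Suc)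
    show "(\<lambda>m. F (Suc m) n t) \<longlonglongrightarrow> path_step g k e n (x (Suc n)) t"
      unfolding FS using lim t by (intro path_step_tendsto) auto
  qed
  with xloop show ?thesis by (rule that)
qed

section \<open>Homomorphisms from the earring group\<close>

lemma (in HE_hom) val_path_pow: "p \<in> HE_loops \<Longrightarrow> val (path_pow p k) = val p [^] k"
  by (induction k) (auto simp: val_const val_join path_pow_loop m_comm)

lemma (in small_tf_reduced_group) HE_hom_factors:
  assumes \<phi>: "\<phi> \<in> hom HE_group A"
  shows "\<exists>N. \<forall>a\<in>carrier HE_group. \<phi> a = \<phi> (HE_proj N a)"
proof (rule ccontr)
  assume neg: "\<not> ?thesis"
  interpret HE_hom A \<phi> by (unfold_locales) (rule \<phi>)
  \<comment> \<open>Take a loop on which \<open>\<phi>\<close> differs from its composite with the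
    projection; by splitting, its inner part has a nontrivial value.\<close>
  have "\<exists>q\<in>HE_loops. (\<forall>t\<in>{0..1}. q t \<in> HE_inner N) \<and> val q \<noteq> \<one>" for N
  proof -
    obtain p where p: "p \<in> HE_loops" "\<phi> (HE_class p) \<noteq> \<phi> (HE_proj N (HE_class p))"
      using neg unfolding HE_group_def by auto
    let ?q = "collapse_onto (HE_inner N) \<circ> p"
    have "val p = val (collapse_onto (HE_outer N) \<circ> p) \<otimes> val ?q"
      using splits_loop[OF p(1)] unfolding splits_def by blast
    moreover have "val p \<noteq> val (collapse_onto (HE_outer N) \<circ> p)"
      using p(2) unfolding val_def HE_proj_class[OF p(1)] .
    ultimately have "val ?q \<noteq> \<one>" using val_closed[OF collapse_outer_loop[OF p(1)]] by auto
    moreover have "?q t \<in> HE_inner N" for t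
      using zero_in_HE_inner by (auto simp: collapse_onto_def)
    ultimately show ?thesis using collapse_inner_loop[OF p(1)] by blast
  qed
  then obtain g where g: "\<And>N. g N \<in> HE_loops" "\<And>N t. t \<in> {0..1} \<Longrightarrow> g N t \<in> HE_inner N"
    "\<And>N. val (g N) \<noteq> \<one>" by metis
  have "\<exists>k>0. \<forall>b\<in>carrier A. b [^] (k::nat) \<noteq> val (g N)" for N
    using bspec[OF red[unfolded no_divisible_elem_def], of "val (g N)"] g by auto
  then obtain k :: "nat \<Rightarrow> nat" where k: "\<And>N. 0 < k N" "\<And>N b. b \<in> carrier A \<Longrightarrow> b [^] k N \<noteq> val (g N)"
    by metis
  show False
  proof (rule nest_coding[of "\<lambda>n. val (g n)" k])
    show "range (\<lambda>n. val (g n)) \<subseteq> carrier A" using g by auto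
    show "\<exists>b\<in>carrier A. \<forall>n. \<exists>y\<in>carrier A. b = nest A (\<lambda>n. val (g n)) k e n y" for e
    proof -
      obtain x where x: "\<And>n. x n \<in> HE_loops"
        "\<And>n t. t \<in> {0..1} \<Longrightarrow> x n t = path_step g k e n (x (Suc n)) t"
        using infinite_concatenation[OF g(1,2)] by metis
      have st: "val (x n) = step A (\<lambda>n. val (g n)) k e n (val (x (Suc n)))" for n
      proof -
        have "val (x n) = val (path_step g k e n (x (Suc n)))"
          using x by (intro val_eq) auto
        also have "\<dots> = step A (\<lambda>n. val (g n)) k e n (val (x (Suc n)))"
          unfolding path_step_def step_def using x(1) g(1)
          by (simp add: val_join path_pow_loop const_in_HE_loops val_path_pow val_const)
        finally show ?thesis .
      qed
      have "val (x 0) = nest A (\<lambda>n. val (g n)) k e n (val (x n))" for n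
      proof (induction n)
        case (Suc n)
        have "val (x 0) = nest A (\<lambda>n. val (g n)) k e n (val (x n))" by (rule Suc)
        also have "\<dots> = nest A (\<lambda>n. val (g n)) k e (Suc n) (val (x (Suc n)))" by (subst st) simp
        finally show ?case .
      qed simp
      then show ?thesis using val_closed[OF x(1)] by blast
    qed
  qed (use k in simp_all)
qed

section \<open>Product groups, transport of topologies and limits\<close>

lemma topological_group_product:
  assumes D: "group D"
  shows "topological_group (product_group UNIV (\<lambda>i::'i. D)) (product_topology (\<lambda>i. discrete_topology (carrier D)) UNIV)"
    (is "topological_group ?P ?T")
  unfolding topological_group_def
proof (intro conjI)
  show P: "group ?P" using D by simp
  show ts: "topspace ?T = carrier ?P" by simp
  have proj: "continuous_map ?T (discrete_topology (carrier D)) (\<lambda>x. x i)" for i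
    by (rule continuous_map_product_projection) simp
  have "continuous_map (prod_topology ?T ?T) ?T (\<lambda>w i. fst w i \<otimes>\<^bsub>D\<^esub> snd w i)"
    unfolding continuous_map_componentwise_UNIV
  proof
    fix i
    have "continuous_map (prod_topology ?T ?T) (discrete_topology (carrier D \<times> carrier D)) (\<lambda>w. (fst w i, snd w i))"
      unfolding prod_topology_discrete_topology
      using continuous_map_compose[OF continuous_map_fst proj] continuous_map_compose[OF continuous_map_snd proj]
      by (intro continuous_map_pairedI) (auto simp: o_def)
    moreover have "continuous_map (discrete_topology (carrier D \<times> carrier D)) (discrete_topology (carrier D))
        (\<lambda>(a, b). a \<otimes>\<^bsub>D\<^esub> b)"
      using D by (auto simp: group.is_monoid monoid.m_closed)
    ultimately have "continuous_map (prod_topology ?T ?T) (discrete_topology (carrier D))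
        ((\<lambda>(a, b). a \<otimes>\<^bsub>D\<^esub> b) \<circ> (\<lambda>w. (fst w i, snd w i)))"
      by (rule continuous_map_compose)
    then show "continuous_map (prod_topology ?T ?T) (discrete_topology (carrier D)) (\<lambda>w. fst w i \<otimes>\<^bsub>D\<^esub> snd w i)"
      by (simp add: o_def)
  qed
  then show "continuous_map (prod_topology ?T ?T) ?T (\<lambda>(x, y). x \<otimes>\<^bsub>?P\<^esub> y)"
    by (simp add: case_prod_beta' restrict_def)
  have "continuous_map ?T ?T (\<lambda>x i. inv\<^bsub>D\<^esub> x i)"
    unfolding continuous_map_componentwise_UNIV
  proof
    fix i
    have "continuous_map (discrete_topology (carrier D)) (discrete_topology (carrier D)) (\<lambda>a. inv\<^bsub>D\<^esub> a)"
      using D by (auto simp: group.inv_closed)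
    from continuous_map_compose[OF proj this]
    show "continuous_map ?T (discrete_topology (carrier D)) (\<lambda>x. inv\<^bsub>D\<^esub> x i)" by (simp add: o_def)
  qed
  then show "continuous_map ?T ?T (\<lambda>x. inv\<^bsub>?P\<^esub> x)"
    by (rule continuous_map_eq) (use D in \<open>simp add: restrict_def\<close>)
qed

lemma completely_metrizable_product_discrete:
  "completely_metrizable_space (product_topology (\<lambda>i::nat. discrete_topology C) UNIV)"
  unfolding completely_metrizable_space_product_topology
  by (simp add: completely_metrizable_space_discrete_topology)

lemma openin_product_discrete_cylinder:
  assumes "openin (product_topology (\<lambda>i::nat. discrete_topology C) UNIV) U" "x \<in> U"
  obtains n where "\<And>y. (\<And>i. y i \<in> C) \<Longrightarrow> (\<And>i. i < n \<Longrightarrow> y i = x i) \<Longrightarrow> y \<in> U"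
proof -
  obtain B where B: "x \<in> (\<Pi>\<^sub>E i\<in>UNIV. B i)" "finite {i. B i \<noteq> C}" "(\<Pi>\<^sub>E i\<in>UNIV. B i) \<subseteq> U"
    using product_topology_open_contains_basis[OF assms] by auto
  obtain n where n: "\<And>i. B i \<noteq> C \<Longrightarrow> i < n"
    using B(2) unfolding finite_nat_set_iff_bounded by auto
  show ?thesis
  proof (rule that[of n])
    fix y assume y: "\<And>i. y i \<in> C" "\<And>i. i < n \<Longrightarrow> y i = x i"
    have "y i \<in> B i" for i
      using y[of i] n[of i] PiE_mem[OF B(1), of i] by (cases "i < n") auto
    then show "y \<in> U" using B(3) by auto
  qed
qed

lemma ZN_product_group: "ZN = product_group UNIV (\<lambda>i. integer_group)"
  unfolding ZN_def product_group_def integer_group_def by (simp add: restrict_def)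

lemma ZN_simps [simp]: "carrier ZN = UNIV" "x \<otimes>\<^bsub>ZN\<^esub> y = (\<lambda>i. x i + y i)" "\<one>\<^bsub>ZN\<^esub> = (\<lambda>i. 0)"
  by (simp_all add: ZN_def)

text \<open>The integer sequences form a completely metrizable group in the product topology, so the
  kernel is open and, for some \<open>n\<close>, contains all sequences that vanish below
  \<open>n\<close>. A sequence and its truncation differ by one of these.\<close>

lemma (in small_tf_reduced_group) slender: "slender A"
  unfolding slender_def
proof
  fix \<phi> assume \<phi>: "\<phi> \<in> hom ZN A"
  let ?T = "product_topology (\<lambda>i::nat. discrete_topology (UNIV :: int set)) UNIV"
  have TG: "topological_group ZN ?T"
    unfolding ZN_product_group using topological_group_product[of integer_group] by simp
  then have "openin ?T (kernel ZN A \<phi>)"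
    using completely_metrizable_open_kernel[OF _ \<phi>] completely_metrizable_product_discrete by blast
  moreover interpret ZN: group ZN using TG unfolding topological_group_def by blast
  interpret \<phi>: group_hom ZN A \<phi> by (unfold_locales) (rule \<phi>)
  have "(\<lambda>i. 0) \<in> kernel ZN A \<phi>" using \<phi>.hom_one by (simp add: kernel_def)
  ultimately obtain n where n: "\<And>y. (\<And>i. i < n \<Longrightarrow> y i = 0) \<Longrightarrow> y \<in> kernel ZN A \<phi>"
    by (rule openin_product_discrete_cylinder) auto
  have "\<phi> x = \<phi> (trunc_seq n x)" for x
  proof -
    have "x = trunc_seq n x \<otimes>\<^bsub>ZN\<^esub> (\<lambda>i. x i - trunc_seq n x i)" by (simp add: fun_eq_iff)
    then have "\<phi> x = \<phi> (trunc_seq n x) \<otimes> \<phi> (\<lambda>i. x i - trunc_seq n x i)"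
      using \<phi>.hom_mult by (metis UNIV_I ZN_simps(1))
    moreover have "(\<lambda>i. x i - trunc_seq n x i) \<in> kernel ZN A \<phi>"
      by (rule n) (simp add: trunc_seq_def)
    ultimately show ?thesis by (simp add: kernel_def \<phi>.hom_closed)
  qed
  then show "\<exists>n. \<forall>x\<in>carrier ZN. \<phi> x = \<phi> (trunc_seq n x)" by blast
qed

text \<open>\<open>cm_slender\<close> and \<open>lcH_slender\<close> quantify over groups on the
  fixed type \<open>'g\<close>, so a test group on another type is first copied into
  \<open>'g\<close> along an injection.\<close>

lemma topological_group_transport:
  fixes G :: "('h, 'm) monoid_scheme"
  assumes TG: "topological_group G T" and le: "carrier G \<lesssim> (UNIV :: 'g set)"
  obtains G' :: "'g monoid" and T' h where "topological_group G' T'" "homeomorphic_map T' T h" "h \<in> hom G' G"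
proof -
  interpret G: group G using TG unfolding topological_group_def by blast
  have ts: "topspace T = carrier G" and mult: "continuous_map (prod_topology T T) T (\<lambda>(x, y). x \<otimes>\<^bsub>G\<^esub> y)"
    and inv: "continuous_map T T (\<lambda>x. inv\<^bsub>G\<^esub> x)"
    using TG unfolding topological_group_def by auto
  obtain j :: "'h \<Rightarrow> 'g" where j: "inj_on j (carrier G)" using le unfolding lepoll_def by blast
  define C where "C = j ` carrier G"
  define h where "h = inv_into (carrier G) j"
  have hj [simp]: "h (j x) = x" if "x \<in> carrier G" for x using j that unfolding h_def by simp
  have jh [simp]: "j (h x) = x" "h x \<in> carrier G" if "x \<in> C" for x
    using that unfolding C_def h_def by (auto simp: f_inv_into_f inv_into_into)
  have jC [simp]: "j x \<in> C" if "x \<in> carrier G" for x using that unfolding C_def by simp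
  define G' :: "'g monoid" where "G' = \<lparr>carrier = C, mult = (\<lambda>x y. j (h x \<otimes>\<^bsub>G\<^esub> h y)), one = j \<one>\<^bsub>G\<^esub>\<rparr>"
  have G'_simps [simp]: "carrier G' = C" "x \<otimes>\<^bsub>G'\<^esub> y = j (h x \<otimes>\<^bsub>G\<^esub> h y)" "\<one>\<^bsub>G'\<^esub> = j \<one>\<^bsub>G\<^esub>" for x y
    unfolding G'_def by auto
  have "group G'"
  proof (rule groupI)
    show "\<exists>y\<in>carrier G'. y \<otimes>\<^bsub>G'\<^esub> x = \<one>\<^bsub>G'\<^esub>" if "x \<in> carrier G'" for x
      using that by (intro bexI[of _ "j (inv\<^bsub>G\<^esub> h x)"]) auto
  qed (auto simp: G.m_assoc)
  then interpret G': group G' .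
  have inv': "inv\<^bsub>G'\<^esub> x = j (inv\<^bsub>G\<^esub> h x)" if "x \<in> C" for x
    using that by (intro G'.inv_equality) auto
  \<comment> \<open>The pullback of \<open>T\<close> along the bijection \<open>h\<close> turns
    \<open>h\<close> into a homeomorphism.\<close>
  define T' where "T' = pullback_topology C h T"
  have ts': "topspace T' = C" unfolding T'_def topspace_pullback_topology using ts by auto
  have ch: "continuous_map T' T h"
    using continuous_map_pullback[of T T id C h] unfolding T'_def by simp
  have into: "continuous_map S T' f" if "continuous_map S T (h \<circ> f)" "f ` topspace S \<subseteq> C" for S and f :: "'x \<Rightarrow> 'g"
    unfolding T'_def using that by (intro continuous_map_pullback') auto
  show ?thesis
  proof (rule that)
    show "topological_group G' T'"
      unfolding topological_group_def
    proof (intro conjI)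
      have "continuous_map (prod_topology T' T') (prod_topology T T) (\<lambda>w. (h (fst w), h (snd w)))"
        using continuous_map_compose[OF continuous_map_fst ch] continuous_map_compose[OF continuous_map_snd ch]
        by (intro continuous_map_pairedI) (auto simp: o_def)
      then have "continuous_map (prod_topology T' T') T (\<lambda>w. h (fst w) \<otimes>\<^bsub>G\<^esub> h (snd w))"
        using continuous_map_compose[OF _ mult] by (fastforce simp: o_def)
      then have "continuous_map (prod_topology T' T') T (h \<circ> (\<lambda>(x, y). x \<otimes>\<^bsub>G'\<^esub> y))"
        by (rule continuous_map_eq) (auto simp: ts')
      then show "continuous_map (prod_topology T' T') T' (\<lambda>(x, y). x \<otimes>\<^bsub>G'\<^esub> y)"
        by (rule into) (auto simp: ts')
      have "continuous_map T' T (\<lambda>x. inv\<^bsub>G\<^esub> h x)"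
        using continuous_map_compose[OF ch inv] by (simp add: o_def)
      then have "continuous_map T' T (h \<circ> (\<lambda>x. inv\<^bsub>G'\<^esub> x))"
        by (rule continuous_map_eq) (auto simp: ts' inv')
      then show "continuous_map T' T' (\<lambda>x. inv\<^bsub>G'\<^esub> x)"
        by (rule into) (auto simp: ts' inv')
    qed (auto simp: ts' \<open>group G'\<close>)
    have "continuous_map T T (h \<circ> j)"
      by (rule continuous_map_eq[of _ _ "\<lambda>x. x"]) (auto simp: ts)
    then have "continuous_map T T' j" by (rule into) (auto simp: ts)
    then have "homeomorphic_maps T' T h j"
      unfolding homeomorphic_maps_def using ch by (auto simp: ts ts')
    then show "homeomorphic_map T' T h" using homeomorphic_map_maps by blast
    show "h \<in> hom G' G" by (auto simp: hom_def)
  qed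
qed

text \<open>The test groups used later are completely metrizable as well as locally compact, so
  either kind of slenderness applies to them and one argument refutes both.\<close>

lemma openin_kernel_transport:
  fixes G :: "('h, 'm) monoid_scheme"
  assumes TG: "topological_group G T" and le: "carrier G \<lesssim> (UNIV :: 'g set)"
    and cm: "completely_metrizable_space T" and lc: "locally_compact_space T"
    and slender: "cm_slender TYPE('g) A \<or> lcH_slender TYPE('g) A"
    and \<phi>: "\<phi> \<in> hom G A"
  shows "openin T (kernel G A \<phi>)"
proof -
  obtain G' :: "'g monoid" and T' h where TG': "topological_group G' T'"
    and h: "homeomorphic_map T' T h" "h \<in> hom G' G"
    using topological_group_transport[OF TG le] by blast
  have ts: "topspace T = carrier G" "topspace T' = carrier G'"
    using TG TG' unfolding topological_group_def by auto
  have homeo: "T' homeomorphic_space T"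
    using h(1) homeomorphic_map_imp_homeomorphic_space by blast
  have comp: "\<phi> \<circ> h \<in> hom G' A" using hom_compose[OF h(2) \<phi>] .
  have "Hausdorff_space T"
    using cm completely_metrizable_imp_metrizable_space metrizable_imp_Hausdorff_space by blast
  then have "openin T' (kernel G' A (\<phi> \<circ> h))"
    using slender TG' comp cm lc homeo homeomorphic_completely_metrizable_space[OF homeo]
      homeomorphic_locally_compact_space[OF homeo] homeomorphic_Hausdorff_space[OF homeo]
    unfolding cm_slender_def lcH_slender_def by blast
  then have "openin T (h ` kernel G' A (\<phi> \<circ> h))"
    using h(1) homeomorphic_map_openness_eq by blast
  moreover have "h ` carrier G' = carrier G"
    using h(1) ts homeomorphic_imp_surjective_map by metis
  then have "h ` kernel G' A (\<phi> \<circ> h) = kernel G A \<phi>"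
    unfolding kernel_def by auto
  ultimately show ?thesis by simp
qed

section \<open>Cardinality, residue limits and rational functionals\<close>

lemma int_sequences_lepoll_reals: "(UNIV :: (nat \<Rightarrow> int) set) \<lesssim> (UNIV :: real set)"
proof -
  \<comment> \<open>A sequence is coded by its graph, as a set of naturals.\<close>
  have "inj (\<lambda>(x :: nat \<Rightarrow> int). range (\<lambda>i. prod_encode (i, int_encode (x i))))"
  proof (rule injI)
    fix x y :: "nat \<Rightarrow> int"
    assume eq: "range (\<lambda>i. prod_encode (i, int_encode (x i))) = range (\<lambda>i. prod_encode (i, int_encode (y i)))"
    have "x i = y i" for i
    proof -
      have "prod_encode (i, int_encode (x i)) \<in> range (\<lambda>i. prod_encode (i, int_encode (y i)))"
        using eq by blast
      then have "int_encode (x i) = int_encode (y i)" by auto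
      then show ?thesis by (rule injD[OF inj_int_encode])
    qed
    then show "x = y" by auto
  qed
  then have "(UNIV :: (nat \<Rightarrow> int) set) \<lesssim> (UNIV :: nat set set)"
    unfolding lepoll_def by blast
  then show ?thesis using nat_sets_eqpoll_reals by (meson eqpoll_imp_lepoll lepoll_trans)
qed

text \<open>A cluster point of the coordinate projections \<open>x \<mapsto> x n mod k\<close>, in place of a limit along a
  free ultrafilter.\<close>

lemma exists_residue_limit:
  assumes "0 < (k :: int)"
  obtains l :: "(nat \<Rightarrow> int) \<Rightarrow> int"
  where "\<And>F N. finite F \<Longrightarrow> \<exists>n\<ge>N. \<forall>x\<in>F. l x = x n mod k"
proof -
  let ?D = "\<lambda>x :: nat \<Rightarrow> int. discrete_topology {0..<k}"
  let ?T = "product_topology ?D UNIV"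
  \<comment> \<open>The compact space is a power of the set of residues, indexed by all integer
    sequences; its point \<open>e n\<close> is evaluation at coordinate \<open>n\<close> modulo
    \<open>k\<close>.\<close>
  define e where "e n = (\<lambda>x :: nat \<Rightarrow> int. x n mod k)" for n
  have "compact_space ?T"
    unfolding compact_space_product_topology by (simp add: compact_space_discrete_topology)
  moreover have "e n \<in> topspace ?T" for n
    using assms unfolding e_def by auto
  then have ne: "?T closure_of (e ` {n..}) \<noteq> {}" for n
    using closure_of_subset[of "e ` {n..}" ?T] by (auto simp: image_subset_iff)
  have "decseq (\<lambda>n. ?T closure_of (e ` {n..}))"
    by (intro decseq_SucI closure_of_mono image_mono) auto
  ultimately have "(\<Inter>n. ?T closure_of (e ` {n..})) \<noteq> {}"
    using ne by (intro compact_space_imp_nest) auto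
  then obtain l where l: "\<And>n. l \<in> ?T closure_of (e ` {n..})" by blast
  show ?thesis
  proof (rule that)
    fix F :: "(nat \<Rightarrow> int) set" and N :: nat
    assume "finite F"
    \<comment> \<open>The basic neighbourhood that prescribes \<open>l\<close> on \<open>F\<close>
      only; as \<open>l\<close> is a cluster point, some \<open>e n\<close> with
      \<open>N \<le> n\<close> lies in it.\<close>
    define V where "V = (\<Pi>\<^sub>E x\<in>UNIV. if x \<in> F then {l x} else {0..<k})"
    have lts: "l \<in> topspace ?T" using l[of 0] by (simp add: in_closure_of)
    have "openin ?T V"
      unfolding V_def
    proof (rule product_topology_basis)
      show "openin (?D x) (if x \<in> F then {l x} else {0..<k})" for x
        using lts by (auto simp: PiE_iff)
      show "finite {x. (if x \<in> F then {l x} else {0..<k}) \<noteq> topspace (?D x)}"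
        by (rule finite_subset[OF _ \<open>finite F\<close>]) (auto split: if_splits)
    qed
    moreover have "l \<in> V" using lts unfolding V_def by (auto simp: PiE_iff)
    ultimately obtain n where n: "N \<le> n" "e n \<in> V"
      using l[of N] unfolding in_closure_of by blast
    have "l x = x n mod k" if "x \<in> F" for x
      using n(2) that unfolding V_def e_def by (auto simp: PiE_iff split: if_splits)
    then show "\<exists>n\<ge>N. \<forall>x\<in>F. l x = x n mod k" using n(1) by blast
  qed
qed

text \<open>A basis of \<open>S\<close> together with \<open>v\<close> is independent, so a linear
  map to the rationals may be prescribed as 0 on the basis and 1 at \<open>v\<close>.\<close>

lemma exists_rational_functional:
  fixes scale :: "rat \<Rightarrow> 'v::ab_group_add \<Rightarrow> 'v"
  assumes vs: "vector_space scale" and S: "module.subspace scale S" and v: "v \<notin> S"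
  obtains f :: "'v \<Rightarrow> rat" where "\<And>x y. f (x + y) = f x + f y" "\<And>x. x \<in> S \<Longrightarrow> f x = 0" "f v = 1"
proof -
  interpret vs: vector_space scale by fact
  interpret rat: vector_space "(*) :: rat \<Rightarrow> rat \<Rightarrow> rat"
    by unfold_locales (auto simp: algebra_simps)
  interpret pair: vector_space_pair scale "(*) :: rat \<Rightarrow> rat \<Rightarrow> rat" ..
  obtain B where B: "B \<subseteq> S" "vs.independent B" "S \<subseteq> vs.span B"
    using vs.maximal_independent_subset[of S] by blast
  have spanB: "vs.span B = S" using B S vs.span_minimal by blast
  then have "vs.independent (insert v B)"
    using B(2) v by (intro vs.independent_insertI) auto
  then obtain f where f: "Vector_Spaces.linear scale (*) f" "\<forall>x\<in>insert v B. f x = (if x = v then 1 else 0)"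
    using pair.linear_independent_extend[of "insert v B" "\<lambda>x. if x = v then 1 else 0"] by blast
  interpret f: Vector_Spaces.linear scale "(*)" f by (rule f(1))
  show ?thesis
  proof (rule that[of f])
    show "f (x + y) = f x + f y" for x y by (rule f.add)
    show "f v = 1" using f(2) by simp
    have "f x = 0" if "x \<in> B" for x using f(2) that v B(1) by auto
    then show "f x = 0" if "x \<in> S" for x
      using pair.linear_eq_0_on_span[OF f(1)] that spanB by blast
  qed
qed

section \<open>Winding numbers\<close>

text \<open>Multiplication by the imaginary unit. The quarter turn puts the centres on the negative
  real axis and the base point at angle zero of every circle, where \<open>circlepath\<close>
  starts.\<close>

definition cplx_of :: "real \<times> real \<Rightarrow> complex" where
  "cplx_of z = Complex (- snd z) (fst z)"

text \<open>A point inside the first \<open>Suc i\<close> circles and outside all others.\<close>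

definition HE_hole :: "nat \<Rightarrow> complex" where
  "HE_hole i = of_real (- (1 / real (Suc i) + 1 / real (Suc (Suc i))))"

text \<open>The winding number of a closed path is a complex number with integer value; the floor of
  its real part recovers the integer.\<close>

definition wind :: "(real \<Rightarrow> real \<times> real) \<Rightarrow> nat \<Rightarrow> int" where
  "wind p i = \<lfloor>Re (winding_number (cplx_of \<circ> p) (HE_hole i))\<rfloor>"

lemma continuous_on_cplx_of: "continuous_on S cplx_of"
  unfolding cplx_of_def complex_of_real_def[symmetric] Complex_eq by (intro continuous_intros)

text \<open>Besides the origin, circle \<open>n\<close> meets the axis at distance
  \<open>2 / n\<close>, while the hole lies strictly between the values for \<open>Suc i\<close> and
  \<open>Suc (Suc i)\<close>; no integer fits between these two.\<close>

lemma HE_hole_notin: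
  assumes "z \<in> HE"
  shows "cplx_of z \<noteq> HE_hole i"
proof
  assume eq: "cplx_of z = HE_hole i"
  define y where "y = 1 / real (Suc i) + 1 / real (Suc (Suc i))"
  have "snd z = y" "fst z = 0"
    using arg_cong[OF eq, of Re] arg_cong[OF eq, of Im] unfolding cplx_of_def HE_hole_def y_def by simp_all
  moreover obtain n where "real n * ((fst z)\<^sup>2 + (snd z)\<^sup>2) = 2 * snd z"
    using assms by (blast elim: HE_E)
  ultimately have "real n * y * y = 2 * y" by (simp add: power2_eq_square mult.assoc)
  moreover have "0 < y" unfolding y_def by (intro add_pos_pos) auto
  ultimately have ny: "real n * y = 2" by simp
  have "real (Suc i) * y = 1 + real (Suc i) / real (Suc (Suc i))"
    "real (Suc (Suc i)) * y = real (Suc (Suc i)) / real (Suc i) + 1"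
    unfolding y_def by (simp_all add: distrib_left del: of_nat_Suc)
  moreover have "real (Suc i) / real (Suc (Suc i)) < 1" "1 < real (Suc (Suc i)) / real (Suc i)"
    by simp_all
  ultimately have "real (Suc i) * y < 2" "2 < real (Suc (Suc i)) * y"
    by linarith+
  then have "real (Suc i) * y < real n * y" "real n * y < real (Suc (Suc i)) * y"
    using ny by auto
  then have "real (Suc i) < real n" "real n < real (Suc (Suc i))" using \<open>0 < y\<close> by auto
  then show False by (simp only: of_nat_less_iff)
qed

lemma winding_number_loop:
  assumes "p \<in> HE_loops"
  shows "path (cplx_of \<circ> p)" "HE_hole i \<notin> path_image (cplx_of \<circ> p)"
    "pathfinish (cplx_of \<circ> p) = pathstart (cplx_of \<circ> p)"
    "winding_number (cplx_of \<circ> p) (HE_hole i) = of_int (wind p i)"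
proof -
  note p = HE_loopsD[OF assms]
  show 1: "path (cplx_of \<circ> p)" using p(1) continuous_on_cplx_of by (rule path_continuous_image)
  show 2: "HE_hole i \<notin> path_image (cplx_of \<circ> p)"
    unfolding path_image_compose using p(2) HE_hole_notin by (metis imageE subsetD)
  show 3: "pathfinish (cplx_of \<circ> p) = pathstart (cplx_of \<circ> p)"
    using p by (simp add: pathfinish_compose pathstart_compose)
  have "winding_number (cplx_of \<circ> p) (HE_hole i) \<in> \<int>"
    using integer_winding_number[OF 1 3 2] .
  then show "winding_number (cplx_of \<circ> p) (HE_hole i) = of_int (wind p i)"
    unfolding wind_def by (auto elim!: Ints_cases)
qed

lemma wind_homotopic:
  assumes "homotopic_paths HE p q"
  shows "wind p = wind q"
proof
  fix i
  have "homotopic_paths (- {HE_hole i}) (cplx_of \<circ> p) (cplx_of \<circ> q)"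
    using assms HE_hole_notin
    by (intro homotopic_paths_continuous_image[where S = HE] continuous_on_cplx_of) auto
  then show "wind p i = wind q i"
    unfolding wind_def by (simp add: winding_number_homotopic_paths)
qed

lemma wind_join:
  assumes p: "p \<in> HE_loops" and q: "q \<in> HE_loops"
  shows "wind (p +++ q) i = wind p i + wind q i"
proof -
  have "pathfinish (cplx_of \<circ> p) = pathstart (cplx_of \<circ> q)"
    using HE_loopsD[OF p] HE_loopsD[OF q] by (simp add: pathfinish_compose pathstart_compose)
  then have "winding_number (cplx_of \<circ> (p +++ q)) (HE_hole i) = of_int (wind p i) + of_int (wind q i)"
    unfolding path_compose_join
    using winding_number_loop[OF p] winding_number_loop[OF q] by (subst winding_number_join) auto
  then show ?thesis unfolding wind_def[of "p +++ q"] by simp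
qed

lemma wind_const: "wind (\<lambda>t. 0) i = 0"
proof -
  have "cplx_of 0 \<noteq> HE_hole i" using HE_hole_notin zero_in_HE by blast
  moreover have "cplx_of \<circ> (\<lambda>t. 0) = linepath (cplx_of 0) (cplx_of 0)" by (auto simp: linepath_def)
  ultimately show ?thesis unfolding wind_def by (simp add: winding_number_trivial)
qed

section \<open>The winding homomorphism to integer sequences\<close>

definition HE_wind :: "(real \<Rightarrow> real \<times> real) set \<Rightarrow> nat \<Rightarrow> int" where
  "HE_wind a = wind (SOME p. p \<in> a)"

lemma HE_wind_class: "p \<in> HE_loops \<Longrightarrow> HE_wind (HE_class p) = wind p"
  unfolding HE_wind_def using wind_homotopic[OF HE_some_homotopic] by metis

lemma HE_wind_hom: "HE_wind \<in> hom HE_group ZN"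
proof (rule homI)
  fix a b assume "a \<in> carrier HE_group" "b \<in> carrier HE_group"
  then obtain p q where "p \<in> HE_loops" "a = HE_class p" "q \<in> HE_loops" "b = HE_class q"
    unfolding HE_group_def by auto
  then show "HE_wind (a \<otimes>\<^bsub>HE_group\<^esub> b) = HE_wind a \<otimes>\<^bsub>ZN\<^esub> HE_wind b"
    by (simp add: HE_mult_class HE_wind_class HE_loops_join wind_join fun_eq_iff)
qed simp

text \<open>The standard circle moved back by the inverse of \<open>cplx_of\<close>; index
  \<open>n\<close> runs around circle \<open>Suc n\<close>.\<close>

definition circle_loop :: "nat \<Rightarrow> real \<Rightarrow> real \<times> real" where
  "circle_loop n t = (let c = circlepath (- 1 / of_nat (Suc n)) (1 / real (Suc n)) t in (Im c, - Re c))"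

lemma cplx_of_circle_loop: "cplx_of \<circ> circle_loop n = circlepath (- 1 / of_nat (Suc n)) (1 / real (Suc n))"
  by (simp add: fun_eq_iff cplx_of_def circle_loop_def Let_def)

lemma circle_loop_in_circle:
  assumes "t \<in> {0..1}"
  shows "circle_loop n t \<in> HE_circle (Suc n)"
proof -
  let ?c = "circlepath (- 1 / of_nat (Suc n)) (1 / real (Suc n)) t"
  have "?c \<in> path_image (circlepath (- 1 / of_nat (Suc n)) (1 / real (Suc n)))"
    using assms unfolding path_image_def by blast
  then have "?c \<in> sphere (- 1 / of_nat (Suc n)) (1 / real (Suc n))"
    by (simp add: path_image_circlepath)
  then have "dist ?c (- 1 / of_nat (Suc n)) = 1 / real (Suc n)"
    by (simp only: mem_sphere dist_commute)
  then have "cmod (?c + 1 / of_nat (Suc n)) = 1 / real (Suc n)"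
    unfolding dist_norm by simp
  moreover have "1 / of_nat (Suc n) = complex_of_real (1 / real (Suc n))" by simp
  ultimately have "sqrt ((Re ?c + 1 / real (Suc n))\<^sup>2 + (Im ?c)\<^sup>2) = 1 / real (Suc n)"
    unfolding cmod_def by simp
  then show ?thesis
    unfolding HE_circle_def circle_loop_def Let_def
    by (simp add: dist_Pair_Pair dist_real_def power2_eq_square algebra_simps)
qed

lemma circle_loop_in_loops: "circle_loop n \<in> HE_loops"
proof (rule HE_loopsI)
  have "circle_loop n = (\<lambda>c. (Im c, - Re c)) \<circ> circlepath (- 1 / of_nat (Suc n)) (1 / real (Suc n))"
    by (simp add: fun_eq_iff circle_loop_def Let_def)
  moreover have "path ((\<lambda>c. (Im c, - Re c)) \<circ> circlepath (- 1 / of_nat (Suc n)) (1 / real (Suc n)))"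
    by (intro path_continuous_image continuous_intros) simp
  ultimately show "path (circle_loop n)" by simp
  show "path_image (circle_loop n) \<subseteq> HE"
    using circle_loop_in_circle unfolding path_image_def hawaiian_earring_def by fastforce
qed (simp_all add: pathstart_def pathfinish_def circle_loop_def circlepath zero_prod_def Let_def)

text \<open>The holes move towards the base point as \<open>i\<close> grows, and circle
  \<open>Suc n\<close> encloses exactly those from \<open>i = n\<close> on. The vector is thus a
  tail of the constant sequence 1, not a unit vector.\<close>

lemma wind_circle_loop: "wind (circle_loop n) i = (if n \<le> i then 1 else 0)"
proof -
  let ?r = "1 / real (Suc n)"
  let ?h = "1 / real (Suc i) + 1 / real (Suc (Suc i))"
  have c: "- 1 / of_nat (Suc n) = complex_of_real (- ?r)" by simp
  have "HE_hole i - complex_of_real (- ?r) = complex_of_real (?r - ?h)"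
    unfolding HE_hole_def by simp
  then have d: "cmod (HE_hole i - complex_of_real (- ?r)) = \<bar>?r - ?h\<bar>"
    by (simp only: norm_of_real)
  have pos: "0 < ?h" by (intro add_pos_pos) auto
  show ?thesis
  proof (cases "n \<le> i")
    case True
    have "1 / real (Suc i) \<le> ?r" using True by (intro divide_left_mono) auto
    moreover have "1 / real (Suc (Suc i)) < 1 / real (Suc i)" by (intro divide_strict_left_mono) auto
    ultimately have "\<bar>?r - ?h\<bar> < ?r" using pos by (simp only: abs_less_iff) linarith
    then have "winding_number (circlepath (complex_of_real (- ?r)) ?r) (HE_hole i) = 1"
      using d by (intro winding_number_circlepath) simp
    then show ?thesis unfolding wind_def cplx_of_circle_loop c using True by simp
  next
    case False
    have "?r \<le> 1 / real (Suc (Suc i))" using False by (intro divide_left_mono) auto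
    moreover have "1 / real (Suc (Suc i)) < 1 / real (Suc i)" by (intro divide_strict_left_mono) auto
    ultimately have "?r < \<bar>?r - ?h\<bar>" by linarith
    then have "HE_hole i \<notin> cball (complex_of_real (- ?r)) ?r"
      using d by (simp add: dist_norm norm_minus_commute)
    then have "winding_number (circlepath (complex_of_real (- ?r)) ?r) (HE_hole i) = 0"
      by (intro winding_number_zero_outside[where s = "cball (complex_of_real (- ?r)) ?r"])
         (auto simp: path_image_circlepath)
    then show ?thesis unfolding wind_def cplx_of_circle_loop c using False by simp
  qed
qed

lemma HE_proj_circle_loop: "HE_proj N (HE_class (circle_loop N)) = HE_class (\<lambda>t. 0)"
proof -
  have "collapse_onto (HE_outer N) (circle_loop N t) = 0" if "t \<in> {0..1}" for t
  proof -
    have c: "circle_loop N t \<in> HE_circle (Suc N)" by (rule circle_loop_in_circle[OF that])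
    then have "circle_loop N t \<in> HE_inner N"
      using HE_circle_iff[of "Suc N" "circle_loop N t"]
      unfolding HE_inner_def hawaiian_earring_def by auto
    then show ?thesis using HE_outer_Int_inner[of N] unfolding collapse_onto_def by auto
  qed
  then have "homotopic_paths HE (\<lambda>t. 0) (collapse_onto (HE_outer N) \<circ> circle_loop N)"
    using HE_loopsD[OF const_in_HE_loops] by (intro homotopic_paths_eq) auto
  then show ?thesis unfolding HE_proj_class[OF circle_loop_in_loops] using HE_class_cong by metis
qed

text \<open>One obstruction to both slenderness and n-slenderness: a truncated constant sequence has
  finite support, and the winding vector of \<open>circle_loop N\<close> differs from the constant
  sequence 1 by a sequence of finite support.\<close>

definition separating_hom :: "('a, 'b) monoid_scheme \<Rightarrow> ((nat \<Rightarrow> int) \<Rightarrow> 'a) \<Rightarrow> bool" where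
  "separating_hom A L \<longleftrightarrow> L \<in> hom ZN A \<and> L (\<lambda>i. 1) \<noteq> \<one>\<^bsub>A\<^esub> \<and> (\<forall>x. finite {i. x i \<noteq> 0} \<longrightarrow> L x = \<one>\<^bsub>A\<^esub>)"

lemma separating_hom_not_slender:
  assumes "separating_hom A L"
  shows "\<not> slender A"
proof
  assume "slender A"
  then obtain n where "L (\<lambda>i. 1) = L (trunc_seq n (\<lambda>i. 1))"
  proof -
    have "\<exists>n. \<forall>x\<in>carrier ZN. L x = L (trunc_seq n x)"
      using \<open>slender A\<close> assms unfolding slender_def separating_hom_def by blast
    then show ?thesis using that by auto
  qed
  moreover have "finite {i. trunc_seq n (\<lambda>i. 1) i \<noteq> 0}"
    by (rule finite_subset[of _ "{..<n}"]) (auto simp: trunc_seq_def)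
  ultimately show False using assms unfolding separating_hom_def by simp
qed

lemma separating_hom_not_n_slender:
  assumes A: "group A" and L: "separating_hom A L"
  shows "\<not> n_slender A"
proof
  interpret A: group A by fact
  assume "n_slender A"
  have Lhom: "L \<in> hom ZN A" using L unfolding separating_hom_def by blast
  obtain N where N: "\<And>a. a \<in> carrier HE_group \<Longrightarrow> (L \<circ> HE_wind) a = (L \<circ> HE_wind) (HE_proj N a)"
    using \<open>n_slender A\<close> hom_compose[OF HE_wind_hom Lhom] unfolding n_slender_def by blast
  have "HE_class (circle_loop N) \<in> carrier HE_group"
    unfolding HE_group_def using circle_loop_in_loops by simp
  then have "L (wind (circle_loop N)) = L (wind (\<lambda>t. 0))"
    using N[of "HE_class (circle_loop N)"]
    by (simp add: HE_proj_circle_loop HE_wind_class circle_loop_in_loops const_in_HE_loops)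
  also have "wind (\<lambda>t. 0) = (\<lambda>i. 0)" by (simp add: fun_eq_iff wind_const)
  also have "L (\<lambda>i. 0) = \<one>\<^bsub>A\<^esub>" using L unfolding separating_hom_def by simp
  finally have Lw: "L (wind (circle_loop N)) = \<one>\<^bsub>A\<^esub>" .
  \<comment> \<open>The initial segment missing from the winding vector of
    \<open>circle_loop N\<close>.\<close>
  define u where "u = (\<lambda>i. if i < N then 1 else 0 :: int)"
  have "finite {i. u i \<noteq> 0}" by (rule finite_subset[of _ "{..<N}"]) (auto simp: u_def)
  then have Lu: "L u = \<one>\<^bsub>A\<^esub>" using L unfolding separating_hom_def by blast
  have "(\<lambda>i. 1) = wind (circle_loop N) \<otimes>\<^bsub>ZN\<^esub> u" by (auto simp: fun_eq_iff wind_circle_loop u_def)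
  then have "L (\<lambda>i. 1) = L (wind (circle_loop N)) \<otimes>\<^bsub>A\<^esub> L u"
    using hom_mult[OF Lhom] by simp
  then show False using Lw Lu L unfolding separating_hom_def by simp
qed

section \<open>Torsion and divisible elements\<close>

lemma lepoll_reals_trans:
  fixes C :: "(nat \<Rightarrow> int) set"
  assumes "(UNIV :: real set) \<lesssim> (UNIV :: 'g set)"
  shows "C \<lesssim> (UNIV :: 'g set)"
  using assms int_sequences_lepoll_reals subset_imp_lepoll[of C UNIV] by (meson lepoll_trans subset_UNIV)

context comm_group
begin

section \<open>Torsion elements\<close>

lemma int_pow_mod:
  assumes "a \<in> carrier G" "a [^] (k::nat) = \<one>"
  shows "a [^] (c mod int k) = a [^] (c :: int)"
proof -
  have "a [^] c = a [^] (int k * (c div int k) + c mod int k)" by simp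
  also have "\<dots> = (a [^] int k) [^] (c div int k) \<otimes> a [^] (c mod int k)"
    using assms(1) by (simp only: int_pow_mult int_pow_pow)
  also have "a [^] int k = \<one>" using assms(2) by (simp add: int_pow_int)
  finally show ?thesis using assms(1) by simp
qed

text \<open>\<open>L\<close> raises \<open>a\<close> to a residue limit. The form with finite sets
  lets any identity among finitely many sequences be read off at one coordinate, as far out as
  desired.\<close>

lemma torsion_limit_hom:
  assumes a: "a \<in> carrier G" "a [^] k = \<one>" and k: "0 < (k::nat)"
  obtains L :: "(nat \<Rightarrow> int) \<Rightarrow> 'a"
  where "\<And>F N. finite F \<Longrightarrow> \<exists>n\<ge>N. \<forall>x\<in>F. L x = a [^] x n"
proof -
  obtain l :: "(nat \<Rightarrow> int) \<Rightarrow> int"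
    where l: "\<And>F N. finite F \<Longrightarrow> \<exists>n\<ge>N. \<forall>x\<in>F. l x = x n mod int k"
    using exists_residue_limit[of "int k"] k by auto
  show ?thesis
  proof (rule that[of "\<lambda>x. a [^] l x"])
    fix F :: "(nat \<Rightarrow> int) set" and N :: nat
    assume "finite F"
    then obtain n where "n \<ge> N" "\<forall>x\<in>F. l x = x n mod int k" using l by blast
    then show "\<exists>n\<ge>N. \<forall>x\<in>F. a [^] l x = a [^] x n" using int_pow_mod[OF a] by auto
  qed
qed

lemma torsion_separating_hom:
  assumes a: "a \<in> carrier G" "a [^] k = \<one>" "a \<noteq> \<one>" and k: "0 < (k::nat)"
  shows "\<exists>L. separating_hom G L"
proof -
  obtain L :: "(nat \<Rightarrow> int) \<Rightarrow> 'a" where L: "\<And>F N. finite F \<Longrightarrow> \<exists>n\<ge>N. \<forall>x\<in>F. L x = a [^] x n"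
    by (rule torsion_limit_hom[OF a(1,2) k]) blast
  have "L \<in> hom ZN G"
  proof (rule homI)
    show "L x \<in> carrier G" for x using L[of "{x}" 0] a(1) by auto
    show "L (x \<otimes>\<^bsub>ZN\<^esub> y) = L x \<otimes> L y" for x y
      using L[of "{x, y, x \<otimes>\<^bsub>ZN\<^esub> y}" 0] a(1) by (auto simp: int_pow_mult)
  qed
  moreover have "L (\<lambda>i. 1) \<noteq> \<one>" using L[of "{\<lambda>i. 1}" 0] a by auto
  moreover have "L x = \<one>" if fin: "finite {i. x i \<noteq> 0}" for x
  proof -
    obtain N where N: "\<And>i. x i \<noteq> 0 \<Longrightarrow> i < N"
      using fin unfolding finite_nat_set_iff_bounded by auto
    obtain n where "n \<ge> N" "L x = a [^] x n" using L[of "{x}" N] by auto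
    moreover have "x n = 0" using N[of n] \<open>n \<ge> N\<close> by auto
    ultimately show ?thesis by simp
  qed
  ultimately show ?thesis unfolding separating_hom_def by blast
qed

text \<open>The same limit is taken on the compact group of sequences over the integers modulo
  \<open>k\<close>. An open kernel would contain a cylinder, yet a sequence that is 0 below
  \<open>n\<close> and 1 from there on has the limit value \<open>a\<close>.\<close>

lemma torsion_not_topologically_slender:
  assumes a: "a \<in> carrier G" "a [^] k = \<one>" "a \<noteq> \<one>" and k: "0 < (k::nat)"
    and g: "(UNIV :: real set) \<lesssim> (UNIV :: 'g set)"
  shows "\<not> (cm_slender TYPE('g) G \<or> lcH_slender TYPE('g) G)"
proof
  assume slender: "cm_slender TYPE('g) G \<or> lcH_slender TYPE('g) G"
  obtain L :: "(nat \<Rightarrow> int) \<Rightarrow> 'a" where L: "\<And>F N. finite F \<Longrightarrow> \<exists>n\<ge>N. \<forall>x\<in>F. L x = a [^] x n"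
    by (rule torsion_limit_hom[OF a(1,2) k]) blast
  let ?D = "integer_mod_group k"
  let ?P = "product_group (UNIV :: nat set) (\<lambda>i. ?D)"
  let ?T = "product_topology (\<lambda>i::nat. discrete_topology (carrier ?D)) UNIV"
  have TG: "topological_group ?P ?T" by (rule topological_group_product) simp
  have "compact_space ?T"
    unfolding compact_space_product_topology using k
    by (simp add: compact_space_discrete_topology carrier_integer_mod_group)
  then have lc: "locally_compact_space ?T" by (rule compact_imp_locally_compact_space)
  have hom: "L \<in> hom ?P G"
  proof (rule homI)
    show "L x \<in> carrier G" for x using L[of "{x}" 0] a(1) by auto
    show "L (x \<otimes>\<^bsub>?P\<^esub> y) = L x \<otimes> L y" for x y
    proof -
      obtain n where "L x = a [^] x n" "L y = a [^] y n" "L (x \<otimes>\<^bsub>?P\<^esub> y) = a [^] (x \<otimes>\<^bsub>?P\<^esub> y) n"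
        using L[of "{x, y, x \<otimes>\<^bsub>?P\<^esub> y}" 0] by blast
      \<comment> \<open>Addition in the product is modulo \<open>k\<close>, which does not affect
        powers of \<open>a\<close>.\<close>
      then show ?thesis using a(1,2) by (simp add: int_pow_mod int_pow_mult)
    qed
  qed
  have "openin ?T (kernel ?P G L)"
    using openin_kernel_transport[OF TG lepoll_reals_trans[OF g] completely_metrizable_product_discrete lc slender hom] .
  moreover have "(\<lambda>i. 0) \<in> kernel ?P G L"
    using L[of "{\<lambda>i. 0}" 0] k by (auto simp: kernel_def carrier_integer_mod_group)
  ultimately obtain n where n: "\<And>y. (\<And>i. y i \<in> carrier ?D) \<Longrightarrow> (\<And>i. i < n \<Longrightarrow> y i = 0) \<Longrightarrow> y \<in> kernel ?P G L"
    by (rule openin_product_discrete_cylinder) blast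
  define y where "y = (\<lambda>i. if i < n then 0 else 1 mod int k)"
  have "y \<in> kernel ?P G L"
    by (rule n) (use k in \<open>auto simp: y_def carrier_integer_mod_group\<close>)
  then have "L y = \<one>" unfolding kernel_def by simp
  moreover obtain m where "n \<le> m" "L y = a [^] y m" using L[of "{y}" n] by auto
  moreover have "a [^] (1 mod int k) = a" using int_pow_mod[OF a(1,2), of 1] a(1) by simp
  ultimately show False using a(3) unfolding y_def by simp
qed

section \<open>Divisible elements and rational exponents\<close>

definition root_exp :: "'a \<Rightarrow> rat \<Rightarrow> 'a \<Rightarrow> bool" where
  "root_exp a x b \<longleftrightarrow> b \<in> carrier G \<and>
     (\<exists>(m::int) (n::nat). 0 < n \<and> x = of_int m / of_nat n \<and> b [^] n = a [^] m)"

text \<open>\<open>root_exp a x b\<close> makes \<open>b\<close> a value of \<open>a\<close> to the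
  power \<open>x\<close>, through some fraction for \<open>x\<close>. Comparing two values at the
  product of their denominators shows uniqueness, by torsion-freeness; adding over that common
  denominator gives additivity.\<close>

lemma divisible_rat_hom:
  assumes tf: "torsion_free G" and a: "a \<in> carrier G"
    and div: "\<And>k::nat. 0 < k \<Longrightarrow> \<exists>b\<in>carrier G. b [^] k = a"
  obtains h :: "rat \<Rightarrow> 'a" where "\<And>x. h x \<in> carrier G" "\<And>x y. h (x + y) = h x \<otimes> h y" "h 1 = a"
proof -
  have unique: "b = b'" if b: "root_exp a x b" and b': "root_exp a x b'" for x b b'
  proof -
    obtain m n where mn: "b \<in> carrier G" "0 < n" "x = of_int m / of_nat n" "b [^] n = a [^] (m::int)"
      using b unfolding root_exp_def by blast
    obtain m' n' where mn': "b' \<in> carrier G" "0 < n'" "x = of_int m' / of_nat n'" "b' [^] n' = a [^] (m'::int)"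
      using b' unfolding root_exp_def by blast
    have "of_int (m * int n') = (of_int (m' * int n) :: rat)"
      using mn(2,3) mn'(2,3) by (simp add: field_simps)
    then have eq: "m * int n' = m' * int n" by (simp only: of_int_eq_iff)
    have "b [^] (n * n') = (b [^] n) [^] int n'" using mn(1) by (simp add: nat_pow_pow int_pow_int)
    also have "\<dots> = a [^] (m * int n')" using a unfolding mn(4) by (simp add: int_pow_pow)
    also have "\<dots> = (b' [^] n') [^] int n" using a unfolding mn'(4) eq by (simp add: int_pow_pow)
    also have "\<dots> = b' [^] (n * n')" using mn'(1) by (simp add: nat_pow_pow int_pow_int mult.commute)
    finally show ?thesis using torsion_free_pow_inj[OF tf mn(1) mn'(1), of "n * n'"] mn(2) mn'(2) by simp
  qed
  have exists: "\<exists>b. root_exp a x b" for x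
  proof -
    obtain m n' where q: "quotient_of x = (m, n')" by (cases "quotient_of x")
    then have n': "0 < n'" "x = of_int m / of_int n'"
      using quotient_of_denom_pos quotient_of_div by auto
    then obtain b where b: "b \<in> carrier G" "b [^] nat n' = a" using div[of "nat n'"] by auto
    have "(b [^] m) [^] nat n' = (b [^] nat n') [^] m"
      using b(1) by (simp flip: int_pow_int add: int_pow_pow mult.commute)
    then have "root_exp a x (b [^] m)"
      unfolding root_exp_def using n' b
      by (intro conjI int_pow_closed exI[of _ m] exI[of _ "nat n'"]) auto
    then show ?thesis by blast
  qed
  obtain h where h: "\<And>x. root_exp a x (h x)" using exists by metis
  have add: "root_exp a (x + y) (b \<otimes> c)" if b: "root_exp a x b" and c: "root_exp a y c" for x y b c
  proof -
    obtain m n where mn: "b \<in> carrier G" "0 < n" "x = of_int m / of_nat n" "b [^] n = a [^] (m::int)"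
      using b unfolding root_exp_def by blast
    obtain m' n' where mn': "c \<in> carrier G" "0 < n'" "y = of_int m' / of_nat n'" "c [^] n' = a [^] (m'::int)"
      using c unfolding root_exp_def by blast
    have pow: "(a [^] (i::int)) [^] (j::nat) = a [^] (i * int j)" for i j
      using a int_pow_pow[of a i "int j"] by (simp add: int_pow_int)
    have "b [^] (n * n') = a [^] (m * int n')"
      using mn(1,4) by (simp only: nat_pow_pow[symmetric] pow)
    moreover have "c [^] (n * n') = a [^] (m' * int n)"
      using mn'(1,4) by (simp only: mult.commute[of n n'] nat_pow_pow[symmetric] pow)
    ultimately have "(b \<otimes> c) [^] (n * n') = a [^] (m * int n' + m' * int n)"
      using mn(1) mn'(1) a by (simp add: pow_mult_distrib m_comm int_pow_mult)
    moreover have "x + y = of_int (m * int n' + m' * int n) / of_nat (n * n')"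
      using mn mn' by (simp add: field_simps)
    moreover have "0 < n * n'" using mn(2) mn'(2) by simp
    ultimately show ?thesis unfolding root_exp_def using mn(1) mn'(1) by blast
  qed
  have one: "root_exp a 1 a"
    unfolding root_exp_def using a by (intro conjI exI[of _ 1] exI[of _ "1::nat"]) auto
  show ?thesis
  proof (rule that[of h])
    show "h x \<in> carrier G" for x using h unfolding root_exp_def by blast
    show "h (x + y) = h x \<otimes> h y" for x y using unique h add by blast
    show "h 1 = a" using unique h one by blast
  qed
qed

text \<open>Regard integer sequences as rational ones; a rational functional that kills finite
  supports and is 1 at the constant sequence 1, followed by \<open>h\<close>, does what is
  required.\<close>

lemma rat_hom_separating_hom:
  fixes h :: "rat \<Rightarrow> 'a"
  assumes h: "\<And>x. h x \<in> carrier G" "\<And>x y. h (x + y) = h x \<otimes> h y" "h 1 \<noteq> \<one>"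
  shows "\<exists>L. separating_hom G L"
proof -
  let ?scale = "\<lambda>(q::rat) (x :: nat \<Rightarrow> rat) i. q * x i"
  have vs: "vector_space ?scale"
    by unfold_locales (auto simp: fun_eq_iff algebra_simps)
  then interpret vs: vector_space ?scale .
  let ?S = "{x :: nat \<Rightarrow> rat. finite {i. x i \<noteq> 0}}"
  have sub: "vs.subspace ?S"
    unfolding vs.subspace_def
  proof (intro conjI ballI allI)
    show "0 \<in> ?S" by simp
    show "x + y \<in> ?S" if "x \<in> ?S" "y \<in> ?S" for x y
    proof -
      have "{i. (x + y) i \<noteq> 0} \<subseteq> {i. x i \<noteq> 0} \<union> {i. y i \<noteq> 0}" by auto
      then show ?thesis using that by (auto intro: finite_subset)
    qed
    show "?scale c x \<in> ?S" if "x \<in> ?S" for c x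
    proof -
      have "{i. ?scale c x i \<noteq> 0} \<subseteq> {i. x i \<noteq> 0}" by auto
      then show ?thesis using that by (auto intro: finite_subset)
    qed
  qed
  have "(\<lambda>i. 1) \<notin> ?S" by simp
  then obtain f :: "(nat \<Rightarrow> rat) \<Rightarrow> rat" where f: "\<And>x y. f (x + y) = f x + f y"
    "\<And>x. x \<in> ?S \<Longrightarrow> f x = 0" "f (\<lambda>i. 1) = 1"
    by (rule exists_rational_functional[OF vs sub]) blast
  define L where "L x = h (f (\<lambda>i. of_int (x i)))" for x :: "nat \<Rightarrow> int"
  have "L \<in> hom ZN G"
  proof (rule homI)
    show "L (x \<otimes>\<^bsub>ZN\<^esub> y) = L x \<otimes> L y" for x y
    proof -
      have "(\<lambda>i. of_int ((x \<otimes>\<^bsub>ZN\<^esub> y) i) :: rat) = (\<lambda>i. of_int (x i)) + (\<lambda>i. of_int (y i))"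
        by (simp add: fun_eq_iff)
      then show ?thesis unfolding L_def by (simp only: f(1) h(2))
    qed
  qed (simp add: L_def h)
  moreover have "L (\<lambda>i. 1) \<noteq> \<one>" unfolding L_def using f(3) h(3) by simp
  moreover have "L x = \<one>" if "finite {i. x i \<noteq> 0}" for x
  proof -
    have "h 0 \<otimes> h 0 = h 0" using h(2)[of 0 0] by simp
    then have "h 0 = \<one>" using h(1)[of 0] by simp
    moreover have "f (\<lambda>i. of_int (x i)) = 0" using that by (intro f(2)) simp
    ultimately show ?thesis unfolding L_def by simp
  qed
  ultimately show ?thesis unfolding separating_hom_def by blast
qed

text \<open>Compose \<open>h\<close> with an additive map from the reals to the rationals that takes
  1 to 1. An open kernel would contain the reciprocal of a large integer, hence also its multiple 1,
  against \<open>h 1 \<noteq> \<one>\<close>.\<close>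

lemma rat_hom_not_topologically_slender:
  fixes h :: "rat \<Rightarrow> 'a"
  assumes h: "\<And>x. h x \<in> carrier G" "\<And>x y. h (x + y) = h x \<otimes> h y" "h 1 \<noteq> \<one>"
    and g: "(UNIV :: real set) \<lesssim> (UNIV :: 'g set)"
  shows "\<not> (cm_slender TYPE('g) G \<or> lcH_slender TYPE('g) G)"
proof
  assume slender: "cm_slender TYPE('g) G \<or> lcH_slender TYPE('g) G"
  let ?scale = "\<lambda>(q::rat) (x :: real). of_rat q * x"
  have vs: "vector_space ?scale"
    by unfold_locales (auto simp: algebra_simps of_rat_add of_rat_mult)
  then interpret vs: vector_space ?scale .
  have "vs.subspace {0}" unfolding vs.subspace_def by simp
  then obtain f :: "real \<Rightarrow> rat" where f: "\<And>x y. f (x + y) = f x + f y" "f 1 = 1"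
    using exists_rational_functional[OF vs \<open>vs.subspace {0}\<close>, of 1] by (metis singletonD zero_neq_one)
  define R :: "real monoid" where "R = \<lparr>carrier = UNIV, mult = (+), one = 0\<rparr>"
  have R [simp]: "carrier R = UNIV" "x \<otimes>\<^bsub>R\<^esub> y = x + y" "\<one>\<^bsub>R\<^esub> = 0" for x y
    unfolding R_def by auto
  have "group R"
  proof (rule groupI)
    show "\<exists>y\<in>carrier R. y \<otimes>\<^bsub>R\<^esub> x = \<one>\<^bsub>R\<^esub>" for x by (rule bexI[of _ "- x"]) auto
  qed auto
  then interpret R: group R .
  have inv: "inv\<^bsub>R\<^esub> x = - x" for x by (rule R.inv_equality) auto
  have TG: "topological_group R euclidean"
    unfolding topological_group_def using \<open>group R\<close>
    by (auto simp: inv case_prod_beta' intro!: continuous_intros)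
  have hom: "(\<lambda>x. h (f x)) \<in> hom R G" by (rule homI) (auto simp: f h)
  have "carrier R \<lesssim> (UNIV :: 'g set)" using g by simp
  from openin_kernel_transport[OF TG this completely_metrizable_space_euclidean
      locally_compact_space_euclidean slender hom]
  have "open {x. h (f x) = \<one>}" unfolding kernel_def by simp
  moreover have "h (f 0) = \<one>"
  proof -
    have "h (f 0) \<otimes> h (f 0) = h (f 0)" using f(1)[of 0 0] h(2)[of "f 0" "f 0"] by simp
    then show ?thesis using h(1)[of "f 0"] by simp
  qed
  ultimately obtain e where e: "0 < e" "\<And>x. dist x 0 < e \<Longrightarrow> h (f x) = \<one>"
    unfolding open_dist by auto
  obtain n where n: "inverse (real (Suc n)) < e" using reals_Archimedean[OF e(1)] by blast
  have small: "h (f (inverse (real (Suc n)))) = \<one>" using n by (intro e(2)) (simp add: dist_real_def)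
  have "h (f (real m * inverse (real (Suc n)))) = \<one>" for m
  proof (induction m)
    case (Suc m)
    have "real (Suc m) * inverse (real (Suc n)) = real m * inverse (real (Suc n)) + inverse (real (Suc n))"
      by (simp add: distrib_right)
    then show ?case using Suc small by (simp only: f(1) h(2)) simp
  qed (simp add: \<open>h (f 0) = \<one>\<close>)
  from this[of "Suc n"] have "h (f 1) = \<one>" by (simp del: of_nat_Suc)
  then show False using h(3) f(2) by simp
qed

lemma not_torsion_free_reduced_cases:
  assumes "\<not> (torsion_free G \<and> no_divisible_elem G)"
  obtains (torsion) a and k :: nat where "a \<in> carrier G" "a [^] k = \<one>" "a \<noteq> \<one>" "0 < k"
  | (divisible) h :: "rat \<Rightarrow> 'a" where "\<And>x. h x \<in> carrier G" "\<And>x y. h (x + y) = h x \<otimes> h y" "h 1 \<noteq> \<one>"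
proof (cases "torsion_free G")
  case False
  then show ?thesis using torsion unfolding torsion_free_def by blast
next
  case True
  then obtain a where a: "a \<in> carrier G" "a \<noteq> \<one>" "\<And>k::nat. 0 < k \<Longrightarrow> \<exists>b\<in>carrier G. b [^] k = a"
    using assms unfolding no_divisible_elem_def by blast
  obtain h :: "rat \<Rightarrow> 'a" where "\<And>x. h x \<in> carrier G" "\<And>x y. h (x + y) = h x \<otimes> h y" "h 1 = a"
    by (rule divisible_rat_hom[OF True a(1,3)]) auto
  then show ?thesis using divisible[of h] a(2) by blast
qed

end

section \<open>The equivalence\<close>

text \<open>The test groups are confined to one type \<open>'g\<close>; when it has room for the
  reals, it holds copies of all groups used for the negative direction.\<close>

theorem theoremC:
  fixes A :: "'a monoid"
  assumes "comm_group A"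
    and "\<not> (UNIV :: real set) \<lesssim> carrier A"
    and "(UNIV :: real set) \<lesssim> (UNIV :: 'g set)"
  shows "(slender A \<longleftrightarrow> n_slender A) \<and>
         (slender A \<longleftrightarrow> cm_slender TYPE('g) A) \<and>
         (slender A \<longleftrightarrow> lcH_slender TYPE('g) A)"
proof (cases "torsion_free A \<and> no_divisible_elem A")
  case True
  then interpret small_tf_reduced_group A
    using assms(1,2) by (simp add: small_tf_reduced_group_def small_tf_reduced_group_axioms_def)
  have "n_slender A" unfolding n_slender_def using HE_hom_factors by blast
  moreover have "cm_slender TYPE('g) A"
    unfolding cm_slender_def using completely_metrizable_open_kernel by blast
  moreover have "lcH_slender TYPE('g) A"
    unfolding lcH_slender_def using locally_compact_open_kernel by blast
  ultimately show ?thesis using slender by blast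
next
  case False
  interpret comm_group A by fact
  have "\<exists>L. separating_hom A L"
    using False
    by (cases rule: not_torsion_free_reduced_cases) (auto intro: torsion_separating_hom rat_hom_separating_hom)
  then have "\<not> slender A" "\<not> n_slender A"
    using separating_hom_not_slender separating_hom_not_n_slender[OF is_group] by blast+
  moreover have "\<not> (cm_slender TYPE('g) A \<or> lcH_slender TYPE('g) A)"
    using False
  proof (cases rule: not_torsion_free_reduced_cases)
    case (torsion a k)
    then show ?thesis using assms(3) by (rule torsion_not_topologically_slender)
  next
    case (divisible h)
    then show ?thesis using assms(3) by (rule rat_hom_not_topologically_slender)
  qed
  ultimately show ?thesis by blast
qed

end
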